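(* For every $1\le k\le e-1$, the monoid $M([1,\lambda^k])$ is a Garside monoid with Garside element $\underline{\lambda^k}$ and set of simples $\underline{D_k}=\{\underline{w}: w\in[1,\lambda^k]\}$. In particular it embeds in its group of fractions $G(M([1,\lambda^k]))$.
   Context: Let $e\ge 2$, $n\ge 2$, $\zeta_e=e^{2\pi i/e}$. $G(e,e,n)$ is the group of $n\times n$ monomial matrices with nonzero entries $e$-th roots of unity whose product is $1$. For $i\in\mathbb{Z}/e\mathbb{Z}$, $t_i$ is the matrix with $(1,2)$ entry $\zeta_e^{-i}$, $(2,1)$ entry $\zeta_e^{i}$, $(j,j)$ entry $1$ for $3\le j\le n$, other entries $0$; for $3\le j\le n$, $s_j$ is the permutation matrix of the transposition $(j-1\ j)$. $X=\{t_0,\dots,t_{e-1},s_3,\dots,s_n\}$ and $\ell$ is the word length with respect to $X$. Write $u\preceq w$ if $\ell(u)+\ell(u^{-1}w)=\ell(w)$; $[1,g]=\{w:w\preceq g\}$. $\lambda=\mathrm{diag}(\zeta_e^{-(n-1)},\zeta_e,\dots,\zeta_e)$. The interval monoid $M([1,\lambda^k])$ is defined by the monoid presentation with generating set $\{\underline{w}: w\in[1,\lambda^k]\}$ (a formal copy of $[1,\lambda^k]$) and relations $\underline{w}=\underline{w'}\,\underline{w''}$ whenever $w,w',w''\in[1,\lambda^k]$, $w=w'w''$ and $\ell(w)=\ell(w')+\ell(w'')$. A Garside monoid $M$ is one that is cancellative, admits $\lambda:M\to\mathbb{N}$ with $\lambda(fg)\ge\lambda(f)+\lambda(g)$ and $\lambda(g)\neq0$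 for $g\ne1$, in which any two elements have left and right gcds and lcms (for left and right divisibility), and which has an element $\Delta$ (a Garside element) whose left and right divisors coincide, form a finite set (the simples), and generate $M$.
   Formalization: The presentation of M([1,λ^k]) is given the extra relation that the generator for 1 is the unit; with the stated relations alone that generator is only a non-identity idempotent, so the monoid would not be cancellative. *)

theory Defs
  imports "Jordan_Normal_Form.Matrix" "HOL-Algebra.Group"
begin

text \<open>Matrix indices are 0-based: the paper's entry (a,b) is our entry (a-1,b-1).\<close>

definition zeta :: "nat \<Rightarrow> complex" where
  "zeta e = cis (2 * pi / real e)"

definition Geen :: "nat \<Rightarrow> nat \<Rightarrow> complex mat set" where
  "Geen e n = {A \<in> carrier_mat n n.
      (\<forall>i<n. \<exists>!j. j < n \<and> A $$ (i,j) \<noteq> 0) \<and>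
      (\<forall>j<n. \<exists>!i. i < n \<and> A $$ (i,j) \<noteq> 0) \<and>
      (\<forall>i<n. \<forall>j<n. A $$ (i,j) \<noteq> 0 \<longrightarrow> A $$ (i,j) ^ e = 1) \<and>
      (\<Prod>p\<in>{(i,j). i < n \<and> j < n \<and> A $$ (i,j) \<noteq> 0}. A $$ p) = 1}"

definition tgen :: "nat \<Rightarrow> nat \<Rightarrow> nat \<Rightarrow> complex mat" where
  "tgen e n i = mat n n (\<lambda>(a,b).
      if a = 0 \<and> b = 1 then zeta e powi (- int i)
      else if a = 1 \<and> b = 0 then zeta e powi (int i)
      else if a = b \<and> 2 \<le> a then 1 else 0)"

text \<open>s_j (3 <= j <= n): permutation matrix of the transposition (j-1 j),
  i.e. of the 0-based indices (j-2, j-1).\<close>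
definition sgen :: "nat \<Rightarrow> nat \<Rightarrow> complex mat" where
  "sgen n j = mat n n (\<lambda>(a,b).
      if (a = j - 2 \<and> b = j - 1) \<or> (a = j - 1 \<and> b = j - 2) then 1
      else if a = b \<and> a \<noteq> j - 2 \<and> a \<noteq> j - 1 then 1 else 0)"

definition Xgens :: "nat \<Rightarrow> nat \<Rightarrow> complex mat set" where
  "Xgens e n = {tgen e n i | i. i < e} \<union> {sgen n j | j. 3 \<le> j \<and> j \<le> n}"

definition word_prod :: "nat \<Rightarrow> complex mat list \<Rightarrow> complex mat" where
  "word_prod n xs = foldr (\<lambda>a b. a * b) xs (1\<^sub>m n)"

definition len :: "nat \<Rightarrow> nat \<Rightarrow> complex mat \<Rightarrow> nat" where
  "len e n w = (LEAST m. \<exists>xs. set xs \<subseteq> Xgens e n \<and> length xs = m \<and> word_prod n xs = w)"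

definition minv :: "nat \<Rightarrow> complex mat \<Rightarrow> complex mat" where
  "minv n u = (SOME v. v \<in> carrier_mat n n \<and> u * v = 1\<^sub>m n \<and> v * u = 1\<^sub>m n)"

definition prec :: "nat \<Rightarrow> nat \<Rightarrow> complex mat \<Rightarrow> complex mat \<Rightarrow> bool" where
  "prec e n u w \<longleftrightarrow> len e n u + len e n (minv n u * w) = len e n w"

definition interval :: "nat \<Rightarrow> nat \<Rightarrow> complex mat \<Rightarrow> complex mat set" where
  "interval e n g = {w \<in> Geen e n. prec e n w g}"

definition lam :: "nat \<Rightarrow> nat \<Rightarrow> complex mat" where
  "lam e n = mat n n (\<lambda>(a,b). if a = b then (if a = 0 then zeta e powi (- (int n - 1)) else zeta e)
                               else 0)"

inductive pres_cong :: "('a list \<times> 'a list) set \<Rightarrow> 'a list \<Rightarrow> 'a list \<Rightarrow> bool"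
  for R where
  rel: "(u, v) \<in> R \<Longrightarrow> pres_cong R u v"
| refl: "pres_cong R u u"
| sym: "pres_cong R u v \<Longrightarrow> pres_cong R v u"
| trans: "pres_cong R u v \<Longrightarrow> pres_cong R v w \<Longrightarrow> pres_cong R u w"
| ctxt: "pres_cong R u v \<Longrightarrow> pres_cong R (a @ u @ b) (a @ v @ b)"

definition pres_class :: "('a list \<times> 'a list) set \<Rightarrow> 'a list \<Rightarrow> 'a list set" where
  "pres_class R u = {v. pres_cong R u v}"

definition pres_monoid :: "'a set \<Rightarrow> ('a list \<times> 'a list) set \<Rightarrow> 'a list set monoid" where
  "pres_monoid S R = \<lparr> carrier = pres_class R ` lists S,
      mult = (\<lambda>A B. {w. \<exists>a\<in>A. \<exists>b\<in>B. pres_cong R (a @ b) w}),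
      one = pres_class R [] \<rparr>"

text \<open>The group with the same presentation (the enveloping group / group of fractions):
  generators S and formal inverses, (x,True) = x, (x,False) = x^-1.\<close>
definition pres_group_rels :: "'a set \<Rightarrow> ('a list \<times> 'a list) set \<Rightarrow> (('a \<times> bool) list \<times> ('a \<times> bool) list) set" where
  "pres_group_rels S R =
     {(map (\<lambda>x. (x, True)) u, map (\<lambda>x. (x, True)) v) | u v. (u, v) \<in> R}
     \<union> {([(x, True), (x, False)], []) | x. x \<in> S}
     \<union> {([(x, False), (x, True)], []) | x. x \<in> S}"

definition pres_group :: "'a set \<Rightarrow> ('a list \<times> 'a list) set \<Rightarrow> ('a \<times> bool) list set monoid" where
  "pres_group S R = pres_monoid (S \<times> UNIV) (pres_group_rels S R)"

definition frac_map :: "'a set \<Rightarrow> ('a list \<times> 'a list) set \<Rightarrow> 'a list set \<Rightarrow> ('a \<times> bool) list set" where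
  "frac_map S R A = pres_class (pres_group_rels S R) (map (\<lambda>x. (x, True)) (SOME a. a \<in> A))"

definition ldiv :: "('a, 'b) monoid_scheme \<Rightarrow> 'a \<Rightarrow> 'a \<Rightarrow> bool" where
  "ldiv M a b \<longleftrightarrow> (\<exists>c\<in>carrier M. a \<otimes>\<^bsub>M\<^esub> c = b)"

definition rdiv :: "('a, 'b) monoid_scheme \<Rightarrow> 'a \<Rightarrow> 'a \<Rightarrow> bool" where
  "rdiv M a b \<longleftrightarrow> (\<exists>c\<in>carrier M. c \<otimes>\<^bsub>M\<^esub> a = b)"

definition has_gcds :: "('a, 'b) monoid_scheme \<Rightarrow> ('a \<Rightarrow> 'a \<Rightarrow> bool) \<Rightarrow> bool" where
  "has_gcds M D \<longleftrightarrow> (\<forall>a\<in>carrier M. \<forall>b\<in>carrier M. \<exists>d\<in>carrier M.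
      D d a \<and> D d b \<and> (\<forall>c\<in>carrier M. D c a \<and> D c b \<longrightarrow> D c d))"

definition has_lcms :: "('a, 'b) monoid_scheme \<Rightarrow> ('a \<Rightarrow> 'a \<Rightarrow> bool) \<Rightarrow> bool" where
  "has_lcms M D \<longleftrightarrow> (\<forall>a\<in>carrier M. \<forall>b\<in>carrier M. \<exists>m\<in>carrier M.
      D a m \<and> D b m \<and> (\<forall>c\<in>carrier M. D a c \<and> D b c \<longrightarrow> D m c))"

definition cancellative :: "('a, 'b) monoid_scheme \<Rightarrow> bool" where
  "cancellative M \<longleftrightarrow> (\<forall>a\<in>carrier M. \<forall>b\<in>carrier M. \<forall>c\<in>carrier M.
      (a \<otimes>\<^bsub>M\<^esub> b = a \<otimes>\<^bsub>M\<^esub> c \<longrightarrow> b = c) \<and> (b \<otimes>\<^bsub>M\<^esub> a = c \<otimes>\<^bsub>M\<^esub> a \<longrightarrow> b = c))"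

definition has_norm :: "('a, 'b) monoid_scheme \<Rightarrow> bool" where
  "has_norm M \<longleftrightarrow> (\<exists>nrm :: 'a \<Rightarrow> nat.
      (\<forall>f\<in>carrier M. \<forall>g\<in>carrier M. nrm (f \<otimes>\<^bsub>M\<^esub> g) \<ge> nrm f + nrm g) \<and>
      (\<forall>g\<in>carrier M. g \<noteq> \<one>\<^bsub>M\<^esub> \<longrightarrow> nrm g \<noteq> 0))"

definition mprod :: "('a, 'b) monoid_scheme \<Rightarrow> 'a list \<Rightarrow> 'a" where
  "mprod M xs = foldr (\<lambda>a b. a \<otimes>\<^bsub>M\<^esub> b) xs \<one>\<^bsub>M\<^esub>"

definition garside_element :: "('a, 'b) monoid_scheme \<Rightarrow> 'a \<Rightarrow> bool" where
  "garside_element M \<Delta> \<longleftrightarrow> \<Delta> \<in> carrier M \<and>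
     {a\<in>carrier M. ldiv M a \<Delta>} = {a\<in>carrier M. rdiv M a \<Delta>} \<and>
     finite {a\<in>carrier M. ldiv M a \<Delta>} \<and>
     (\<forall>x\<in>carrier M. \<exists>xs. set xs \<subseteq> {a\<in>carrier M. ldiv M a \<Delta>} \<and> mprod M xs = x)"

definition garside_monoid :: "('a, 'b) monoid_scheme \<Rightarrow> 'a \<Rightarrow> bool" where
  "garside_monoid M \<Delta> \<longleftrightarrow> monoid M \<and> cancellative M \<and> has_norm M \<and>
     has_gcds M (ldiv M) \<and> has_lcms M (ldiv M) \<and>
     has_gcds M (rdiv M) \<and> has_lcms M (rdiv M) \<and>
     garside_element M \<Delta>"

definition interval_rels :: "nat \<Rightarrow> nat \<Rightarrow> complex mat \<Rightarrow> (complex mat list \<times> complex mat list) set" where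
  "interval_rels e n g =
     {([w], [w', w'']) | w w' w''. w \<in> interval e n g \<and> w' \<in> interval e n g \<and> w'' \<in> interval e n g
         \<and> w = w' * w'' \<and> len e n w = len e n w' + len e n w''}
     \<union> {([1\<^sub>m n], [])}"

definition interval_monoid :: "nat \<Rightarrow> nat \<Rightarrow> complex mat \<Rightarrow> complex mat list set monoid" where
  "interval_monoid e n g = pres_monoid (interval e n g) (interval_rels e n g)"

definition underline :: "nat \<Rightarrow> nat \<Rightarrow> complex mat \<Rightarrow> complex mat \<Rightarrow> complex mat list set" where
  "underline e n g w = pres_class (interval_rels e n g) [w]"

end

theory Submission
  imports Defs
begin

text \<open>
  Let \<open>w\<close> have its nonzero entry of row \<open>i\<close> in column \<open>\<sigma>(i)\<close> with value \<open>z\<^sub>i\<close>. A left multiplication by a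
  generator changes by exactly one the sum, over all pairs \<open>j < i\<close>, of \<open>1\<close> if \<open>\<sigma>(j) > \<sigma>(i)\<close> and of
  \<open>2 [z\<^sub>i \<noteq> 1]\<close> otherwise, and some generator lowers it unless \<open>w = 1\<close>; so this sum is the length of \<open>w\<close>.
  It follows that \<open>\<lambda>\<^sup>k\<close> is balanced and that \<open>w\<close> lies in \<open>[1,\<lambda>\<^sup>k]\<close> if and only if \<open>z\<^sub>i\<close> is \<open>1\<close> or \<open>\<zeta>\<^sup>k\<close>
  whenever \<open>\<sigma>(j) < \<sigma>(i)\<close> for some \<open>j < i\<close>. Any two generators have a join in the interval: the rank two
  elements \<open>t\<^sub>i t\<^sub>i\<^sub>-\<^sub>k\<close> (independent of \<open>i\<close>), \<open>x y x\<close> and \<open>x y\<close>. By the criterion of Bjorner, Edelman and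
  Ziegler all joins exist, and transposition carries this over to the suffix order.

  Joins define complements \<open>u (u\v) = v (v\u)\<close> in the interval, which extend to words by pasting squares and
  are compatible with the defining relations of the monoid. This yields cancellation and lcms; gcds
  follow because the length extends to an additive norm. Finally, the monoid acts faithfully by bijections on
  fractions \<open>m \<Delta>\<^sup>-\<^sup>r\<close>, so it embeds in the group with the same presentation.
\<close>

section \<open>Congruences of monoid presentations\<close>

lemma pres_cong_append:
  assumes "pres_cong R u u'" and "pres_cong R v v'"
  shows "pres_cong R (u @ v) (u' @ v')"
  using pres_cong.ctxt[OF assms(1), of "[]" v] pres_cong.ctxt[OF assms(2), of u' "[]"]
  by (auto intro: pres_cong.trans)

lemma pres_cong_lists_iff:
  assumes "\<And>u v. (u, v) \<in> R \<Longrightarrow> u \<in> lists S \<and> v \<in> lists S"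
  shows "pres_cong R u v \<Longrightarrow> u \<in> lists S \<longleftrightarrow> v \<in> lists S"
  by (induction rule: pres_cong.induct) (use assms in auto)

lemma pres_class_eq_iff: "pres_class R u = pres_class R v \<longleftrightarrow> pres_cong R u v"
  unfolding pres_class_def by (auto intro: pres_cong.intros)

subsection \<open>Germs with joins: complements and word reversing\<close>

text \<open>\<open>P a b c\<close> encodes a partial multiplication: the product of \<open>a\<close>
  and \<open>b\<close> is defined and equals \<open>c\<close>. By \<open>P_assoc1\<close> and
  \<open>P_assoc2\<close>, either bracketing of a triple product is defined as soon as the other one
  is. The length \<open>L\<close> makes divisibility antisymmetric.\<close>

locale left_germ =
  fixes D :: "'a set" and P :: "'a \<Rightarrow> 'a \<Rightarrow> 'a \<Rightarrow> bool" and idn :: 'a and L :: "'a \<Rightarrow> nat"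
  assumes P_closed: "P a b c \<Longrightarrow> a \<in> D \<and> b \<in> D \<and> c \<in> D"
    and idn_closed: "idn \<in> D"
    and P_idn_left: "a \<in> D \<Longrightarrow> P idn a a"
    and P_idn_right: "a \<in> D \<Longrightarrow> P a idn a"
    and P_functional: "P a b c \<Longrightarrow> P a b c' \<Longrightarrow> c = c'"
    and P_cancel: "P a b c \<Longrightarrow> P a b' c \<Longrightarrow> b = b'"
    and P_assoc1: "P a b ab \<Longrightarrow> P ab c abc \<Longrightarrow> \<exists>bc. P b c bc \<and> P a bc abc"
    and P_assoc2: "P b c bc \<Longrightarrow> P a bc abc \<Longrightarrow> \<exists>ab. P a b ab \<and> P ab c abc"
    and L_add: "P a b c \<Longrightarrow> L c = L a + L b"
    and L_zero: "a \<in> D \<Longrightarrow> L a = 0 \<longleftrightarrow> a = idn"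
    and ex_join: "u \<in> D \<Longrightarrow> v \<in> D \<Longrightarrow> \<exists>m x y. P u x m \<and> P v y m \<and>
          (\<forall>m' x' y'. P u x' m' \<and> P v y' m' \<longrightarrow> (\<exists>z. P m z m'))"
begin

section \<open>Left divisibility and complements in the germ\<close>

definition le where "le a b \<longleftrightarrow> (\<exists>x. P a x b)"

lemma le_trans: "le a b \<Longrightarrow> le b c \<Longrightarrow> le a c"
  unfolding le_def using P_assoc1 by blast

lemma le_antisym: assumes "le a b" "le b a" shows "a = b"
proof -
  obtain x y where x: "P a x b" and y: "P b y a" using assms by (auto simp: le_def)
  have "L x = 0" using L_add[OF x] L_add[OF y] by simp
  then have "x = idn" using L_zero P_closed x by blast
  then show ?thesis using x P_idn_right P_functional P_closed by blast
qed

definition is_join where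
  "is_join u v m \<longleftrightarrow> le u m \<and> le v m \<and> (\<forall>m'. le u m' \<and> le v m' \<longrightarrow> le m m')"

text \<open>The right complement: \<open>u\<close> times \<open>cmpl u v\<close> is the join of
  \<open>u\<close> and \<open>v\<close>. The description is legitimate, joins being unique by
  antisymmetry and cofactors by \<open>P_cancel\<close>.\<close>

definition cmpl where "cmpl u v = (THE x. \<exists>m. is_join u v m \<and> P u x m)"

lemma is_join_unique: "is_join u v m \<Longrightarrow> is_join u v m' \<Longrightarrow> m = m'"
  unfolding is_join_def using le_antisym by blast

lemma is_join_commute: "is_join u v m \<Longrightarrow> is_join v u m"
  unfolding is_join_def by blast

lemma cmpl_eqI: assumes "is_join u v m" "P u x m" shows "cmpl u v = x"
  unfolding cmpl_def using assms is_join_unique P_cancel by (intro the_equality) blast+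

lemma join_cmpl:
  assumes "u \<in> D" "v \<in> D"
  obtains m where "is_join u v m" "P u (cmpl u v) m" "P v (cmpl v u) m"
proof -
  obtain m x y where m: "P u x m" "P v y m"
    "\<forall>m' x' y'. P u x' m' \<and> P v y' m' \<longrightarrow> (\<exists>z. P m z m')"
    using ex_join[OF assms] by blast
  then have j: "is_join u v m" unfolding is_join_def le_def by blast
  show ?thesis
    using that[OF j] cmpl_eqI[OF j m(1)] cmpl_eqI[OF is_join_commute[OF j] m(2)] m by simp
qed

lemma cmpl_closed: "u \<in> D \<Longrightarrow> v \<in> D \<Longrightarrow> cmpl u v \<in> D"
  by (rule join_cmpl[of u v]) (auto dest: P_closed)

lemma cmpl_le: assumes "P u x v" shows "cmpl u v = x" "cmpl v u = idn"
proof -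
  have v: "v \<in> D" using assms P_closed by blast
  have "is_join u v v" unfolding is_join_def le_def using assms P_idn_right[OF v] by blast
  then show "cmpl u v = x" "cmpl v u = idn"
    using cmpl_eqI assms is_join_commute P_idn_right[OF v] by blast+
qed

lemma cmpl_simps [simp]:
  assumes "a \<in> D" shows "cmpl a a = idn" "cmpl idn a = a" "cmpl a idn = idn"
  using cmpl_le P_idn_left[OF assms] P_idn_right[OF assms] by blast+

text \<open>Pasting of squares: the join of \<open>x\<close> and \<open>w1 w2\<close> is
  \<open>w1\<close> times the join of \<open>cmpl w1 x\<close> and \<open>w2\<close>. In one
  direction, cancelling \<open>w1\<close> from the join \<open>m\<close> leaves a common multiple
  \<open>q\<close> of the latter two; in the other, \<open>w1 m2\<close> is a common multiple of
  \<open>x\<close> and \<open>w\<close>. Both claims then follow by cancellation.\<close>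

lemma cmpl_product:
  assumes w: "P w1 w2 w" and x: "x \<in> D"
  shows "P (cmpl x w1) (cmpl (cmpl w1 x) w2) (cmpl x w)"
    and "cmpl w x = cmpl w2 (cmpl w1 x)"
proof -
  note D = P_closed[OF w]
  obtain m where m: "is_join x w m" "P x (cmpl x w) m" "P w (cmpl w x) m"
    using join_cmpl[of x w] x D by blast
  obtain m1 where m1: "is_join x w1 m1" "P x (cmpl x w1) m1" "P w1 (cmpl w1 x) m1"
    using join_cmpl[of x w1] x D by blast
  obtain m2 where m2: "is_join (cmpl w1 x) w2 m2" "P (cmpl w1 x) (cmpl (cmpl w1 x) w2) m2"
      "P w2 (cmpl w2 (cmpl w1 x)) m2"
    using join_cmpl[of "cmpl w1 x" w2] x D cmpl_closed by blast
  obtain q where q: "P w2 (cmpl w x) q" "P w1 q m" using P_assoc1[OF w m(3)] by blast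
  have "le m1 m" using m1(1) m(2) q(2) unfolding is_join_def le_def by blast
  then obtain z where z: "P m1 z m" by (auto simp: le_def)
  obtain q' where q': "P (cmpl w1 x) z q'" "P w1 q' m" using P_assoc1[OF m1(3) z] by blast
  have "q' = q" using P_cancel q(2) q'(2) by blast
  then have "le m2 q" using m2(1) q(1) q'(1) unfolding is_join_def le_def by blast
  then obtain r where r: "P m2 r q" by (auto simp: le_def)
  \<comment> \<open>The product of \<open>w1\<close> and \<open>m2\<close> is defined because
    \<open>m2\<close> divides \<open>q\<close> and the product of \<open>w1\<close> and
    \<open>q\<close> is \<open>m\<close>.\<close>
  obtain y where y: "P w1 m2 y" "P y r m" using P_assoc2[OF r q(2)] by blast
  have my: "P m1 (cmpl (cmpl w1 x) w2) y"
    using P_assoc2[OF m2(2) y(1)] P_functional m1(3) by blast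
  have wy: "P w (cmpl w2 (cmpl w1 x)) y"
    using P_assoc2[OF m2(3) y(1)] P_functional w by blast
  have "le x y" using le_trans my m1(2) unfolding le_def by blast
  then have "le m y" using m(1) wy unfolding is_join_def le_def by blast
  then have ym: "y = m" using le_antisym y(2) unfolding le_def by blast
  show "cmpl w x = cmpl w2 (cmpl w1 x)" using wy m(3) P_cancel ym by blast
  obtain s where "P (cmpl x w1) (cmpl (cmpl w1 x) w2) s" "P x s m"
    using P_assoc1[OF m1(2) my] ym by blast
  then show "P (cmpl x w1) (cmpl (cmpl w1 x) w2) (cmpl x w)"
    using m(2) P_cancel by blast
qed

text \<open>The product relations never relate the empty word to another word, so the unit letter is
  identified with it explicitly.\<close>

definition rels where "rels = {([w], [w', w'']) | w w' w''. P w' w'' w} \<union> {([idn], [])}"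

abbreviation cng (infix "\<approx>" 50) where "u \<approx> v \<equiv> pres_cong rels u v"

lemmas [trans] = pres_cong.trans[of rels]
lemmas cng_refl [simp, intro] = pres_cong.refl[of rels]

lemma cng_Cons: "u \<approx> v \<Longrightarrow> x # u \<approx> x # v"
  using pres_cong.ctxt[of rels u v "[x]" "[]"] by simp

lemma cng_lists_iff: "u \<approx> v \<Longrightarrow> u \<in> lists D \<longleftrightarrow> v \<in> lists D"
  by (rule pres_cong_lists_iff[of rels]) (auto simp: rels_def idn_closed dest: P_closed)

lemma cng_product: "P a b c \<Longrightarrow> [c] \<approx> [a, b]"
  by (intro pres_cong.rel) (auto simp: rels_def)

lemma cng_idn: "[idn] \<approx> []"
  by (intro pres_cong.rel) (auto simp: rels_def)

lemma cng_idn_Cons: "idn # u \<approx> u"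
  using pres_cong.ctxt[OF cng_idn, of "[]" u] by simp

text \<open>The functions \<open>lw x v\<close>, \<open>rl x v\<close> and \<open>cw u v\<close> read off the grid obtained by pasting the
  squares \<open>x (x\y) = y (y\x)\<close>: they represent \<open>x\v\<close>, \<open>v\x\<close> and \<open>u\v\<close>.
  Complements of letters are letters, so the grid is finite.\<close>

fun lw where
  "lw x [] = []"
| "lw x (y # v) = cmpl x y # lw (cmpl y x) v"

fun rl where
  "rl x [] = x"
| "rl x (y # v) = rl (cmpl y x) v"

fun cw where
  "cw [] v = v"
| "cw (x # u) v = cw u (lw x v)"

lemma lw_append: "lw x (u @ v) = lw x u @ lw (rl x u) v"
  by (induction u arbitrary: x) auto

lemma rl_append: "rl x (u @ v) = rl (rl x u) v"
  by (induction u arbitrary: x) auto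

lemma rl_closed: "x \<in> D \<Longrightarrow> v \<in> lists D \<Longrightarrow> rl x v \<in> D"
  by (induction v arbitrary: x) (auto simp: cmpl_closed)

lemma lw_closed: "x \<in> D \<Longrightarrow> v \<in> lists D \<Longrightarrow> lw x v \<in> lists D"
  by (induction v arbitrary: x) (auto simp: cmpl_closed)

lemma cw_closed: "u \<in> lists D \<Longrightarrow> v \<in> lists D \<Longrightarrow> cw u v \<in> lists D"
proof (induction u arbitrary: v)
  case (Cons x u)
  then show ?case using lw_closed[of x v] by simp
qed simp

lemma cw_append_left: "cw (u @ u') v = cw u' (cw u v)"
  by (induction u arbitrary: v) auto

lemma cw_Nil_right [simp]: "cw u [] = []"
  by (induction u) auto

text \<open>\<open>cw\<close> is defined row by row along its first argument. Cutting off the first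
  column of the grid instead lets inductions run along either side.\<close>

lemma cw_Cons_right: "cw u (y # v) = rl y u # cw (lw y u) v"
  by (induction u arbitrary: y v) auto

lemma cw_append_right: "cw u (v @ v') = cw u v @ cw (cw v u) v'"
  by (induction v arbitrary: u) (auto simp: cw_Cons_right)

text \<open>Splitting a letter along a defining relation is a pasting of squares, so
  \<open>cmpl_product\<close> settles a single relation. The outgoing letter \<open>rl\<close> stays
  equal, not merely congruent; hence the part of the grid behind the changed piece is unaffected and
  the induction passes through contexts.\<close>

lemma lw_rl_cong:
  assumes "u \<approx> v" "u \<in> lists D" "x \<in> D"
  shows "lw x u \<approx> lw x v \<and> rl x u = rl x v"
  using assms
proof (induction arbitrary: x rule: pres_cong.induct)
  case (rel u v)
  from rel.hyps consider w w1 w2 where "u = [w]" "v = [w1, w2]" "P w1 w2 w"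
    | "u = [idn]" "v = []" by (auto simp: rels_def)
  then show ?case
    using cmpl_product[OF _ rel.prems(2)] cng_product cng_idn rel.prems by cases auto
next
  case (sym u v)
  then show ?case using cng_lists_iff[OF sym.hyps] by (auto intro: pres_cong.sym)
next
  case (trans u v w)
  then show ?case using cng_lists_iff[OF trans.hyps(1)] by (auto intro: pres_cong.trans)
next
  case (ctxt u v a b)
  then have "rl x a \<in> D" "lw (rl x a) u \<approx> lw (rl x a) v" "rl (rl x a) u = rl (rl x a) v"
    using rl_closed[of x a] by auto
  then show ?case by (simp add: lw_append rl_append pres_cong.ctxt)
qed simp

lemma cw_cong_right:
  assumes "v \<approx> v'" "u \<in> lists D" "v \<in> lists D"
  shows "cw u v \<approx> cw u v'"
  using assms
proof (induction u arbitrary: v v')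
  case (Cons x u)
  then show ?case using lw_rl_cong[of v v' x] lw_closed[of x v] by auto
qed simp

lemma cw_cong_left:
  assumes "u \<approx> u'" "u \<in> lists D" "v \<in> lists D"
  shows "cw u v \<approx> cw u' v"
  using assms
proof (induction v arbitrary: u u')
  case (Cons y v)
  then show ?case
    using lw_rl_cong[of u u' y] lw_closed[of y u] by (auto simp: cw_Cons_right intro!: cng_Cons)
qed simp

lemma square_cong:
  assumes "x \<in> D" "y \<in> D"
  shows "[x, cmpl x y] \<approx> [y, cmpl y x]"
proof -
  obtain m where "P x (cmpl x y) m" "P y (cmpl y x) m" using join_cmpl[OF assms] by blast
  then show ?thesis
    using pres_cong.trans[OF pres_cong.sym[OF cng_product] cng_product] by blast
qed

text \<open>The two boundary paths of each square are congruent, and a row of the grid is a sequence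
  of squares.\<close>

lemma lw_square: "x \<in> D \<Longrightarrow> v \<in> lists D \<Longrightarrow> x # lw x v \<approx> v @ [rl x v]"
proof (induction v arbitrary: x)
  case (Cons y v)
  have "x # lw x (y # v) = [x, cmpl x y] @ lw (cmpl y x) v" by simp
  also have "\<dots> \<approx> [y, cmpl y x] @ lw (cmpl y x) v"
    using Cons.prems by (intro pres_cong_append square_cong) auto
  also have "\<dots> = y # (cmpl y x # lw (cmpl y x) v)" by simp
  also have "\<dots> \<approx> y # (v @ [rl (cmpl y x) v])"
    using Cons by (intro cng_Cons) (auto simp: cmpl_closed)
  finally show ?case by simp
qed simp

lemma cw_square: "u \<in> lists D \<Longrightarrow> v \<in> lists D \<Longrightarrow> u @ cw u v \<approx> v @ cw v u"
proof (induction u arbitrary: v)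
  case (Cons x u)
  have "(x # u) @ cw (x # u) v = x # (u @ cw u (lw x v))" by simp
  also have "\<dots> \<approx> x # (lw x v @ cw (lw x v) u)"
    using Cons lw_closed[of x v] by (intro cng_Cons) auto
  also have "\<dots> = (x # lw x v) @ cw (lw x v) u" by simp
  also have "\<dots> \<approx> (v @ [rl x v]) @ cw (lw x v) u"
    using Cons by (intro pres_cong_append lw_square) auto
  finally show ?case by (simp add: cw_Cons_right)
qed simp

lemma lw_idn: "u \<in> lists D \<Longrightarrow> lw idn u = u"
  by (induction u) auto

text \<open>Complements respect the congruence, and \<open>lw x\<close> turns \<open>x # u\<close>
  into \<open>idn # u\<close>, so applying it to both sides strips the letter
  \<open>x\<close>.\<close>

lemma left_cancel:
  assumes "x # u \<approx> x # v" "x \<in> D" "u \<in> lists D" "v \<in> lists D"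
  shows "u \<approx> v"
proof -
  have "lw x (x # u) \<approx> lw x (x # v)" using lw_rl_cong[OF assms(1), of x] assms by auto
  then show ?thesis using assms lw_idn[of u] lw_idn[of v] cng_idn_Cons
    by simp (meson pres_cong.sym pres_cong.trans)
qed

lemma left_cancel_append:
  assumes "a @ u \<approx> a @ v" "a \<in> lists D" "u \<in> lists D" "v \<in> lists D"
  shows "u \<approx> v"
  using assms
proof (induction a)
  case (Cons x a)
  then show ?case using left_cancel[of x "a @ u" "a @ v"] by auto
qed simp

lemma cw_prefix:
  assumes "u \<in> lists D" "v \<in> lists D"
  shows "cw u (u @ v) \<approx> v"
  using assms
proof (induction u)
  case (Cons x u)
  have "cw (x # u) ((x # u) @ v) = cw u (idn # (u @ v))" using Cons lw_idn[of "u @ v"] by simp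
  also have "\<dots> \<approx> cw u (u @ v)" using Cons idn_closed by (intro cw_cong_right cng_idn_Cons) auto
  also have "\<dots> \<approx> v" using Cons by simp
  finally show ?case .
qed simp

lemma cw_prefix_left:
  assumes "u \<in> lists D" "v \<in> lists D"
  shows "cw (u @ v) u \<approx> []"
  using cw_cong_right[OF cw_prefix[of u "[]"], of v] assms cw_closed[of u u]
  by (auto simp: cw_append_left)

text \<open>Write \<open>q\<close> for \<open>u @ x\<close> and \<open>p\<close> for
  \<open>v @ cw v u\<close>. As \<open>v\<close> divides \<open>q\<close>, \<open>cw q v\<close> is
  trivial. As \<open>cw v q\<close> represents \<open>y\<close>, the rest of \<open>cw q p\<close>
  represents \<open>cw y (cw v u)\<close>, which is \<open>cw (v @ y) u\<close> and trivial because
  \<open>u\<close> divides \<open>q\<close>. With \<open>cw q p\<close> trivial, the square of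
  \<open>p\<close> and \<open>q\<close> exhibits \<open>q\<close> as a multiple of
  \<open>p\<close>.\<close>

lemma cw_least:
  assumes m: "u @ x \<approx> v @ y" and D: "u \<in> lists D" "v \<in> lists D" "x \<in> lists D" "y \<in> lists D"
  shows "\<exists>z\<in>lists D. (v @ cw v u) @ z \<approx> u @ x"
proof -
  let ?q = "u @ x" and ?p = "v @ cw v u"
  have qD: "?q \<in> lists D" "v @ y \<in> lists D" using D by auto
  have vu: "cw v u \<in> lists D" using D cw_closed by auto
  have pD: "?p \<in> lists D" using vu D(2) by (simp only: append_in_lists_conv)
  have 1: "cw ?q v \<approx> []"
    using cw_cong_left[OF m qD(1) D(2)] cw_prefix_left[of v y] D pres_cong.trans by blast
  have "cw (cw v ?q) (cw v u) \<approx> cw y (cw v u)"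
    using cw_cong_right[OF m D(2) qD(1)] cw_prefix[of v y] D vu cw_closed[OF D(2) qD(1)]
    by (intro cw_cong_left) (auto intro: pres_cong.trans)
  also have "\<dots> = cw (v @ y) u" by (simp add: cw_append_left)
  also have "\<dots> \<approx> cw ?q u" using pres_cong.sym[OF m] qD D by (intro cw_cong_left) auto
  also have "\<dots> \<approx> []" using cw_prefix_left D by blast
  finally have 2: "cw (cw v ?q) (cw v u) \<approx> []" .
  have qp: "cw ?q ?p \<approx> []" using pres_cong_append[OF 1 2] by (simp add: cw_append_right)
  have "?p @ cw ?p ?q \<approx> ?q @ cw ?q ?p" by (rule cw_square[OF pD qD(1)])
  also have "\<dots> \<approx> ?q @ []" using qp by (intro pres_cong_append cng_refl)
  also have "\<dots> = ?q" by simp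
  finally have "?p @ cw ?p ?q \<approx> ?q" .
  then show ?thesis using cw_closed[OF pD qD(1)] by blast
qed

end

subsection \<open>The monoid presented by a germ\<close>

text \<open>A common divisor of greatest norm is a gcd: its lcm with any other common divisor is
  again a common divisor, hence of no greater norm, hence equal to it. The relation \<open>V\<close>
  is kept abstract to cover left and right divisibility at once.\<close>

lemma has_gcds_if_has_lcms:
  fixes nrm :: "'a \<Rightarrow> nat"
  assumes lcm: "has_lcms M V"
    and nrm: "\<And>x y. x \<in> carrier M \<Longrightarrow> y \<in> carrier M \<Longrightarrow> V x y \<Longrightarrow>
                nrm x \<le> nrm y \<and> (nrm x = nrm y \<longrightarrow> x = y)"
    and bot: "z \<in> carrier M" "\<And>y. y \<in> carrier M \<Longrightarrow> V z y"
  shows "has_gcds M V"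
  unfolding has_gcds_def
proof (intro ballI)
  fix a b assume ab: "a \<in> carrier M" "b \<in> carrier M"
  define C where "C d \<longleftrightarrow> d \<in> carrier M \<and> V d a \<and> V d b" for d
  have Cz: "C z" using bot ab by (auto simp: C_def)
  have bd: "\<forall>d. C d \<longrightarrow> nrm d < Suc (nrm a)"
  proof (intro allI impI)
    fix d assume "C d"
    then have "nrm d \<le> nrm a" using nrm[of d a] ab(1) C_def by blast
    then show "nrm d < Suc (nrm a)" by simp
  qed
  have "\<exists>d. C d \<and> (\<forall>c. C c \<longrightarrow> nrm c \<le> nrm d)"
    by (rule ex_has_greatest_nat[of C z nrm, OF Cz bd])
  then obtain d where d: "C d" "\<forall>c. C c \<longrightarrow> nrm c \<le> nrm d" by (elim exE conjE)
  have "V c d" if c: "C c" for c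
  proof -
    obtain m where m: "m \<in> carrier M" "V c m" "V d m"
        "\<And>t. t \<in> carrier M \<Longrightarrow> V c t \<Longrightarrow> V d t \<Longrightarrow> V m t"
      using lcm[unfolded has_lcms_def, THEN bspec, THEN bspec, of c d] c d(1) unfolding C_def by blast
    have "C m" using m c d(1) ab unfolding C_def by blast
    then have "nrm m \<le> nrm d" using d(2) by blast
    then have "d = m" using nrm[of d m] m d(1) unfolding C_def by auto
    then show ?thesis using m by simp
  qed
  then show "\<exists>d\<in>carrier M. V d a \<and> V d b \<and> (\<forall>c\<in>carrier M. V c a \<and> V c b \<longrightarrow> V c d)"
    using d unfolding C_def by blast
qed

text \<open>\<open>mir\<close> is an anti-automorphism of the germ fixing \<open>g\<close>. It
  carries statements about left divisibility over to right divisibility, so joins are assumed on one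
  side only.\<close>

locale garside_germ = left_germ D P idn L
  for D :: "'a set" and P idn L +
  fixes g :: 'a and mir :: "'a \<Rightarrow> 'a"
  assumes finite_D: "finite D"
    and g_closed: "g \<in> D"
    and P_g: "a \<in> D \<Longrightarrow> \<exists>b. P a b g"
    and mir_closed: "a \<in> D \<Longrightarrow> mir a \<in> D"
    and mir_mir: "a \<in> D \<Longrightarrow> mir (mir a) = a"
    and P_mir: "P a b c \<Longrightarrow> P (mir b) (mir a) (mir c)"
    and mir_g: "mir g = g"
begin

section \<open>Mirror images of words and right cancellation\<close>

lemma mir_idn: "mir idn = idn"
  using P_mir[OF P_idn_left[OF idn_closed]] P_cancel P_idn_right mir_closed idn_closed by metis

definition mirw where "mirw u = rev (map mir u)"

lemma mirw_append: "mirw (u @ v) = mirw v @ mirw u"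
  by (simp add: mirw_def)

lemma mirw_closed: "u \<in> lists D \<Longrightarrow> mirw u \<in> lists D"
  by (auto simp: mirw_def mir_closed)

lemma mirw_mirw: "u \<in> lists D \<Longrightarrow> mirw (mirw u) = u"
  by (induction u) (auto simp: mirw_def mir_mir rev_map)

lemma mirw_cong: "u \<approx> v \<Longrightarrow> mirw u \<approx> mirw v"
proof (induction rule: pres_cong.induct)
  case (rel u v)
  then consider a b c where "u = [c]" "v = [a, b]" "P a b c" | "u = [idn]" "v = []"
    by (auto simp: rels_def)
  then show ?case
    by cases (use cng_product[OF P_mir] cng_idn mir_idn in \<open>auto simp: mirw_def\<close>)
next
  case (ctxt u v a b)
  then show ?case using pres_cong.ctxt by (auto simp: mirw_append)
qed (blast intro: pres_cong.refl pres_cong.sym pres_cong.trans)+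

lemma mirw_cong_iff: "u \<in> lists D \<Longrightarrow> v \<in> lists D \<Longrightarrow> mirw u \<approx> mirw v \<longleftrightarrow> u \<approx> v"
  using mirw_cong mirw_mirw by metis

lemma right_cancel_append:
  assumes "u @ a \<approx> v @ a" "a \<in> lists D" "u \<in> lists D" "v \<in> lists D"
  shows "u \<approx> v"
  using left_cancel_append[of "mirw a" "mirw u" "mirw v"] mirw_cong[OF assms(1)]
  by (simp add: mirw_append mirw_closed mirw_cong_iff assms)

lemma P_g_right: assumes "a \<in> D" shows "\<exists>b. P b a g"
  using P_g[OF mir_closed[OF assms]] P_mir mir_mir[OF assms] mir_g by metis

section \<open>The presented monoid and its divisibility relations\<close>

abbreviation cls where "cls \<equiv> pres_class rels"

abbreviation M where "M \<equiv> pres_monoid D rels"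

lemma cls_eq_iff: "cls u = cls v \<longleftrightarrow> u \<approx> v"
  by (rule pres_class_eq_iff)

lemma mult_cls [simp]: "cls u \<otimes>\<^bsub>M\<^esub> cls v = cls (u @ v)"
proof (intro equalityI subsetI)
  fix w assume "w \<in> cls u \<otimes>\<^bsub>M\<^esub> cls v"
  then obtain a b where "u \<approx> a" "v \<approx> b" "a @ b \<approx> w"
    by (auto simp: pres_monoid_def pres_class_def)
  then show "w \<in> cls (u @ v)"
    using pres_cong.trans[OF pres_cong_append] by (simp add: pres_class_def)
qed (auto simp: pres_monoid_def pres_class_def)

lemma carrier_M: "carrier M = cls ` lists D"
  by (simp add: pres_monoid_def)

lemma carrier_ME: assumes "a \<in> carrier M" obtains u where "u \<in> lists D" "a = cls u"
  using assms unfolding carrier_M by blast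

lemma one_M: "\<one>\<^bsub>M\<^esub> = cls []"
  by (simp add: pres_monoid_def)

lemma ldiv_cls_iff: "ldiv M (cls u) (cls v) \<longleftrightarrow> (\<exists>x\<in>lists D. u @ x \<approx> v)"
  by (auto simp: ldiv_def carrier_M cls_eq_iff)

lemma rdiv_cls_iff: "rdiv M (cls u) (cls v) \<longleftrightarrow> (\<exists>x\<in>lists D. x @ u \<approx> v)"
  by (auto simp: rdiv_def carrier_M cls_eq_iff)

lemma rdiv_mirw_iff:
  assumes "u \<in> lists D" "v \<in> lists D"
  shows "rdiv M (cls u) (cls v) \<longleftrightarrow> ldiv M (cls (mirw u)) (cls (mirw v))"
proof -
  have "x @ u \<approx> v \<longleftrightarrow> mirw u @ mirw x \<approx> mirw v" if "x \<in> lists D" for x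
    using mirw_cong_iff[of "x @ u" v] that assms by (simp add: mirw_append)
  moreover have "(\<exists>x\<in>lists D. mirw u @ mirw x \<approx> mirw v) \<longleftrightarrow> (\<exists>x\<in>lists D. mirw u @ x \<approx> mirw v)"
    using mirw_closed mirw_mirw by (metis (no_types, lifting))
  ultimately show ?thesis unfolding ldiv_cls_iff rdiv_cls_iff by blast
qed

lemma monoid_M: "monoid M"
  by (rule monoidI) (auto simp: carrier_M one_M append_in_lists_conv intro!: imageI)

lemma cancellative_M: "cancellative M"
  unfolding cancellative_def
proof (intro ballI)
  fix a b c assume "a \<in> carrier M" "b \<in> carrier M" "c \<in> carrier M"
  then obtain u v w where "a = cls u" "b = cls v" "c = cls w"
      and D: "u \<in> lists D" "v \<in> lists D" "w \<in> lists D"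
    by (metis carrier_ME)
  then show "(a \<otimes>\<^bsub>M\<^esub> b = a \<otimes>\<^bsub>M\<^esub> c \<longrightarrow> b = c) \<and> (b \<otimes>\<^bsub>M\<^esub> a = c \<otimes>\<^bsub>M\<^esub> a \<longrightarrow> b = c)"
    using left_cancel_append[OF _ D] right_cancel_append[OF _ D] by (simp add: cls_eq_iff)
qed

section \<open>The norm induced by the length\<close>

definition wt where "wt u = sum_list (map L u)"

lemma wt_cong: "u \<approx> v \<Longrightarrow> wt u = wt v"
  by (induction rule: pres_cong.induct)
     (auto simp: rels_def wt_def dest: L_add simp: L_zero idn_closed)

lemma wt_zero: "u \<in> lists D \<Longrightarrow> wt u = 0 \<Longrightarrow> u \<approx> []"
proof (induction u)
  case (Cons x u)
  then have "x = idn" "u \<approx> []" using L_zero by (auto simp: wt_def)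
  then show ?case using cng_idn_Cons pres_cong.trans by blast
qed simp

definition nrm where "nrm A = wt (SOME a. a \<in> A)"

lemma nrm_cls: "nrm (cls u) = wt u"
proof -
  have "(SOME a. a \<in> cls u) \<in> cls u" by (rule someI[of _ u]) (simp add: pres_class_def)
  then show ?thesis using wt_cong unfolding nrm_def by (auto simp: pres_class_def)
qed

lemma wt_append: "wt (u @ v) = wt u + wt v"
  by (simp add: wt_def)

lemma has_norm_M: "has_norm M"
  unfolding has_norm_def
proof (intro exI[of _ nrm] conjI ballI impI)
  fix f h assume "f \<in> carrier M" "h \<in> carrier M"
  then obtain u v where "f = cls u" "h = cls v" by (metis carrier_ME)
  then show "nrm f + nrm h \<le> nrm (f \<otimes>\<^bsub>M\<^esub> h)" by (simp add: nrm_cls wt_append)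
next
  fix f assume "f \<in> carrier M" "f \<noteq> \<one>\<^bsub>M\<^esub>"
  then show "nrm f \<noteq> 0" using wt_zero by (metis carrier_ME one_M cls_eq_iff nrm_cls)
qed

section \<open>Lcms and gcds\<close>

lemma has_lcms_ldiv: "has_lcms M (ldiv M)"
  unfolding has_lcms_def carrier_M
proof (intro ballI, elim imageE)
  fix a b u v assume ab: "a = cls u" "b = cls v" and D: "u \<in> lists D" "v \<in> lists D"
  let ?m = "v @ cw v u"
  have cw: "cw u v \<in> lists D" "cw v u \<in> lists D" using D cw_closed by auto
  have "ldiv M a (cls ?m) \<and> ldiv M b (cls ?m)"
    using cw_square[OF D] cw unfolding ab ldiv_cls_iff by blast
  moreover have "ldiv M (cls ?m) c" if c: "c \<in> cls ` lists D" "ldiv M a c" "ldiv M b c" for c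
  proof -
    obtain t where t1: "c = cls t" using c by blast
    obtain x y where t: "c = cls t" "u @ x \<approx> t" "v @ y \<approx> t" "x \<in> lists D" "y \<in> lists D"
      using c(2,3) t1 unfolding ab t1 ldiv_cls_iff by blast
    obtain z where "z \<in> lists D" "?m @ z \<approx> u @ x"
      using cw_least[of u x v y] t D by (meson pres_cong.sym pres_cong.trans)
    then show ?thesis using t pres_cong.trans unfolding t(1) ldiv_cls_iff by blast
  qed
  moreover have "?m \<in> lists D" using D(2) cw(2) by (simp only: append_in_lists_conv)
  ultimately show "\<exists>m\<in>cls ` lists D. ldiv M a m \<and> ldiv M b m \<and>
      (\<forall>c\<in>cls ` lists D. ldiv M a c \<and> ldiv M b c \<longrightarrow> ldiv M m c)"
    by blast
qed

lemma has_lcms_rdiv: "has_lcms M (rdiv M)"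
  unfolding has_lcms_def carrier_M
proof (intro ballI, elim imageE)
  fix a b u v assume ab: "a = cls u" "b = cls v" and D: "u \<in> lists D" "v \<in> lists D"
  obtain w where w: "w \<in> lists D" "ldiv M (cls (mirw u)) (cls w)" "ldiv M (cls (mirw v)) (cls w)"
      "\<And>t. t \<in> lists D \<Longrightarrow> ldiv M (cls (mirw u)) (cls t) \<Longrightarrow> ldiv M (cls (mirw v)) (cls t) \<Longrightarrow>
         ldiv M (cls w) (cls t)"
    using has_lcms_ldiv[unfolded has_lcms_def carrier_M, THEN bspec, THEN bspec,
        OF imageI[OF mirw_closed[OF D(1)]] imageI[OF mirw_closed[OF D(2)]]] by blast
  have w': "mirw w \<in> lists D" using w(1) mirw_closed by blast
  show "\<exists>m\<in>cls ` lists D. rdiv M a m \<and> rdiv M b m \<and>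
      (\<forall>c\<in>cls ` lists D. rdiv M a c \<and> rdiv M b c \<longrightarrow> rdiv M m c)"
  proof (intro bexI[of _ "cls (mirw w)"] conjI ballI impI)
    show "rdiv M a (cls (mirw w))" "rdiv M b (cls (mirw w))"
      using w D w' unfolding ab by (simp_all only: rdiv_mirw_iff mirw_mirw)
    fix c assume "c \<in> cls ` lists D" and c: "rdiv M a c \<and> rdiv M b c"
    then obtain t where t: "t \<in> lists D" "c = cls t" by blast
    then show "rdiv M (cls (mirw w)) c"
      using c w(4)[OF mirw_closed[OF t(1)]] w(1) w' D unfolding ab t(2)
      by (simp only: rdiv_mirw_iff mirw_mirw)
  qed (use w' in blast)
qed

lemma nrm_ldiv:
  assumes "a \<in> carrier M" "b \<in> carrier M" "ldiv M a b"
  shows "nrm a \<le> nrm b \<and> (nrm a = nrm b \<longrightarrow> a = b)"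
proof -
  obtain u v where uv: "a = cls u" "b = cls v" using assms by (metis carrier_ME)
  then obtain x where a: "a = cls u" "b = cls v" "u @ x \<approx> v" "x \<in> lists D"
    using assms(3) unfolding uv ldiv_cls_iff by blast
  have "wt v = wt u + wt x" using wt_cong[OF a(3)] by (simp add: wt_append)
  moreover have "u \<approx> v" if "x \<approx> []"
    using pres_cong_append[OF cng_refl[of u] that] a(3) by simp (meson pres_cong.sym pres_cong.trans)
  ultimately show ?thesis using a wt_zero by (auto simp: nrm_cls cls_eq_iff)
qed

lemma nrm_rdiv:
  assumes "a \<in> carrier M" "b \<in> carrier M" "rdiv M a b"
  shows "nrm a \<le> nrm b \<and> (nrm a = nrm b \<longrightarrow> a = b)"
proof -
  obtain u v where uv: "a = cls u" "b = cls v" using assms by (metis carrier_ME)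
  then obtain x where a: "a = cls u" "b = cls v" "x @ u \<approx> v" "x \<in> lists D"
    using assms(3) unfolding uv rdiv_cls_iff by blast
  have "wt v = wt x + wt u" using wt_cong[OF a(3)] by (simp add: wt_append)
  moreover have "u \<approx> v" if "x \<approx> []"
    using pres_cong_append[OF that cng_refl[of u]] a(3) by simp (meson pres_cong.sym pres_cong.trans)
  ultimately show ?thesis using a wt_zero by (auto simp: nrm_cls cls_eq_iff)
qed

lemma one_divides:
  assumes "a \<in> carrier M"
  shows "ldiv M (cls []) a" "rdiv M (cls []) a"
proof -
  obtain u where u: "u \<in> lists D" "a = cls u" using assms by (rule carrier_ME)
  show "ldiv M (cls []) a" "rdiv M (cls []) a"
    unfolding u ldiv_cls_iff rdiv_cls_iff by (rule bexI[OF _ u(1)], simp)+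
qed

lemma has_gcds_ldiv: "has_gcds M (ldiv M)"
  by (rule has_gcds_if_has_lcms[OF has_lcms_ldiv nrm_ldiv _ one_divides(1)]) (auto simp: carrier_M)

lemma has_gcds_rdiv: "has_gcds M (rdiv M)"
  by (rule has_gcds_if_has_lcms[OF has_lcms_rdiv nrm_rdiv _ one_divides(2)]) (auto simp: carrier_M)

text \<open>The complement of a letter with respect to a word is a single letter, here
  \<open>h\<close>, and \<open>cw [g] u\<close> is trivial because \<open>u\<close> divides
  \<open>g\<close>. So \<open>u @ [h]\<close> represents \<open>g\<close>. In the germ
  \<open>h\<close> has a left cofactor \<open>w\<close> with product \<open>g\<close>, and right
  cancellation of \<open>h\<close> identifies \<open>u\<close> with \<open>w\<close>.\<close>

lemma left_divisor_g:
  assumes ux: "u @ x \<approx> [g]" and D: "u \<in> lists D" "x \<in> lists D"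
  shows "\<exists>w\<in>D. u \<approx> [w]"
proof -
  have gD: "[g] \<in> lists D" using g_closed by simp
  define h where "h = rl g u"
  have h: "h \<in> D" unfolding h_def using rl_closed g_closed D by blast
  have "cw [g] u \<approx> []"
    using cw_cong_left[OF pres_cong.sym[OF ux] gD D(1)] cw_prefix_left[OF D] pres_cong.trans by blast
  then have "[g] @ cw [g] u \<approx> [g] @ []" by (intro pres_cong_append cng_refl)
  moreover have "u @ [h] \<approx> [g] @ cw [g] u"
    using cw_square[OF D(1) gD] by (simp add: cw_Cons_right h_def)
  ultimately have uh: "u @ [h] \<approx> [g]" using pres_cong.trans by fastforce
  obtain w where w: "P w h g" using P_g_right[OF h] by blast
  have "u @ [h] \<approx> [w] @ [h]" using pres_cong.trans[OF uh cng_product[OF w]] by simp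
  then have "u \<approx> [w]" using right_cancel_append[of u "[h]" "[w]"] D h P_closed[OF w] by simp
  then show ?thesis using P_closed[OF w] by blast
qed

lemma left_divisors_g: "{a \<in> carrier M. ldiv M a (cls [g])} = (\<lambda>w. cls [w]) ` D"
proof (intro equalityI subsetI)
  fix a assume "a \<in> {a \<in> carrier M. ldiv M a (cls [g])}"
  then have a: "a \<in> carrier M" "ldiv M a (cls [g])" by auto
  obtain u where u: "u \<in> lists D" "a = cls u" using a(1) by (rule carrier_ME)
  obtain x where "x \<in> lists D" "u @ x \<approx> [g]" using a(2) unfolding u ldiv_cls_iff by blast
  with u show "a \<in> (\<lambda>w. cls [w]) ` D" using left_divisor_g[of u x] by (auto simp: cls_eq_iff)
next
  fix a assume "a \<in> (\<lambda>w. cls [w]) ` D"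
  then obtain w where w: "w \<in> D" "a = cls [w]" by blast
  then obtain b where b: "P w b g" using P_g by blast
  then have "[w] @ [b] \<approx> [g]" using cng_product[OF b] pres_cong.sym by fastforce
  then have "\<exists>x\<in>lists D. [w] @ x \<approx> [g]" using P_closed[OF b] by (intro bexI[of _ "[b]"]) auto
  then show "a \<in> {a \<in> carrier M. ldiv M a (cls [g])}"
    using w unfolding carrier_M w(2) by (simp only: ldiv_cls_iff mem_Collect_eq) (auto intro!: imageI)
qed

text \<open>Mirroring fixes \<open>g\<close> and permutes the letters, which reduces the claim to
  \<open>left_divisors_g\<close>.\<close>

lemma right_divisors_g: "{a \<in> carrier M. rdiv M a (cls [g])} = (\<lambda>w. cls [w]) ` D"
proof -
  have gD: "[g] \<in> lists D" "mirw [g] = [g]" using g_closed mir_g by (auto simp: mirw_def)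
  have *: "rdiv M (cls u) (cls [g]) \<longleftrightarrow> cls (mirw u) \<in> (\<lambda>w. cls [w]) ` D" if "u \<in> lists D" for u
    using rdiv_mirw_iff[OF that gD(1)] gD(2) left_divisors_g mirw_closed[OF that] carrier_M by auto
  have **: "cls (mirw u) \<in> (\<lambda>w. cls [w]) ` D \<longleftrightarrow> cls u \<in> (\<lambda>w. cls [w]) ` D"
    if u: "u \<in> lists D" for u
  proof -
    have "mirw u \<approx> [w] \<longleftrightarrow> u \<approx> [mir w]" if "w \<in> D" for w
      using mirw_cong_iff[of u "[mir w]"] u that by (simp add: mirw_def mir_closed mir_mir)
    then have "(\<exists>w\<in>D. mirw u \<approx> [w]) \<longleftrightarrow> (\<exists>w\<in>D. u \<approx> [w])"
      using mir_closed mir_mir by (metis (no_types, lifting))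
    then show ?thesis unfolding image_iff cls_eq_iff .
  qed
  have "rdiv M a (cls [g]) \<longleftrightarrow> a \<in> (\<lambda>w. cls [w]) ` D" if a: "a \<in> carrier M" for a
    using a by (rule carrier_ME) (simp only: * **)
  moreover have "(\<lambda>w. cls [w]) ` D \<subseteq> carrier M" using left_divisors_g by blast
  ultimately show ?thesis by blast
qed

lemma mprod_cls: "mprod M (map (\<lambda>x. cls [x]) u) = cls u"
  by (induction u) (auto simp: mprod_def one_M)

lemma garside_element_g: "garside_element M (cls [g])"
  unfolding garside_element_def left_divisors_g right_divisors_g
proof (intro conjI ballI)
  fix x assume "x \<in> carrier M"
  then obtain u where u: "u \<in> lists D" "x = cls u" by (auto simp: carrier_M)
  then show "\<exists>xs. set xs \<subseteq> (\<lambda>w. cls [w]) ` D \<and> mprod M xs = x"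
    by (intro exI[of _ "map (\<lambda>x. cls [x]) u"]) (auto simp: mprod_cls)
qed (use finite_D g_closed in \<open>auto simp: carrier_M\<close>)

theorem garside_monoid_M: "garside_monoid M (cls [g])"
  unfolding garside_monoid_def
  using monoid_M cancellative_M has_norm_M has_gcds_ldiv has_lcms_ldiv has_gcds_rdiv has_lcms_rdiv
    garside_element_g by blast

end

subsection \<open>Embedding into the group of fractions\<close>

context garside_germ
begin

abbreviation gpow where "gpow r \<equiv> replicate r g"

lemma gpow_closed: "gpow r \<in> lists D"
  using g_closed by (induction r) auto

lemma gpow_commute: "gpow r @ gpow s = gpow s @ gpow r"
  by (simp add: add.commute flip: replicate_add)

text \<open>If \<open>x y = g\<close> and \<open>y z = g\<close>, then
  \<open>x g = x y z = g z\<close>, so \<open>g\<close> moves to the left across a letter at the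
  price of replacing that letter. This supplies the preimages in
  \<open>act_converse_left\<close>.\<close>

lemma g_commute: "u \<in> lists D \<Longrightarrow> \<exists>v\<in>lists D. u @ [g] \<approx> g # v"
proof (induction u)
  case Nil
  then show ?case by (intro bexI[of _ "[]"]) auto
next
  case (Cons x u)
  then obtain v where v: "v \<in> lists D" "u @ [g] \<approx> g # v" by auto
  have x: "x \<in> D" using Cons.prems by simp
  obtain y where y: "P x y g" using P_g x by blast
  obtain z where z: "P y z g" using P_g P_closed y by blast
  have "(x # u) @ [g] \<approx> [x] @ [g] @ v" using cng_Cons[OF v(2)] by simp
  also have "\<dots> \<approx> [x] @ [y, z] @ v"
    using cng_product[OF z] by (intro pres_cong.ctxt)
  also have "\<dots> = [] @ [x, y] @ (z # v)" by simp
  also have "\<dots> \<approx> [] @ [g] @ (z # v)"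
    using pres_cong.sym[OF cng_product[OF y]] by (intro pres_cong.ctxt)
  finally show ?case using v(1) P_closed[OF z] by (intro bexI[of _ "z # v"]) auto
qed

text \<open>A pair \<open>(m, r)\<close> stands for the fraction \<open>m g\<^sup>-\<^sup>r\<close>; \<open>act u\<close> is the graph of left multiplication
  by \<open>u\<close> on such fractions, so that \<open>act []\<close> is equality of fractions.\<close>

definition act where
  "act u = {((m, r), (m', r')). m \<in> lists D \<and> m' \<in> lists D \<and> u @ m @ gpow r' \<approx> m' @ gpow r}"

lemma act_iff:
  "((m, r), (m', r')) \<in> act u \<longleftrightarrow> m \<in> lists D \<and> m' \<in> lists D \<and> u @ m @ gpow r' \<approx> m' @ gpow r"
  by (simp add: act_def)

lemma act_cong: assumes "u \<approx> v" shows "act u = act v"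
proof -
  have "u @ w \<approx> t \<longleftrightarrow> v @ w \<approx> t" for w t
    using pres_cong_append[OF assms cng_refl[of w]] pres_cong.sym pres_cong.trans by blast
  then show ?thesis unfolding act_def by simp
qed

lemma gpow_cancel: "a @ gpow r \<approx> b @ gpow r \<Longrightarrow> a \<in> lists D \<Longrightarrow> b \<in> lists D \<Longrightarrow> a \<approx> b"
  using right_cancel_append gpow_closed by blast

lemma cng_append_gpow: "a \<approx> b \<Longrightarrow> a @ gpow r \<approx> b @ gpow r"
  by (intro pres_cong_append cng_refl)

lemma closed_append: "a \<in> lists D \<Longrightarrow> b \<in> lists D \<Longrightarrow> a @ b \<in> lists D"
  by simp

text \<open>Fractions are cross-multiplied. As \<open>g\<close> is in general not central, the
  computation interchanges only powers of \<open>g\<close> with one another and cancels one of them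
  on the right. Relational composition applies its left factor first, whence the order of
  \<open>u\<close> and \<open>v\<close>.\<close>

lemma act_comp:
  assumes D: "u \<in> lists D" "v \<in> lists D"
  shows "act v O act u = act (u @ v)"
proof (intro equalityI subrelI)
  fix p q assume "(p, q) \<in> act v O act u"
  then obtain z where z: "(p, z) \<in> act v" "(z, q) \<in> act u" by blast
  obtain m r m1 r1 m2 r2 where p: "p = (m, r)" "z = (m1, r1)" "q = (m2, r2)"
    by (metis surj_pair)
  have 1: "v @ m @ gpow r1 \<approx> m1 @ gpow r" and 2: "u @ m1 @ gpow r2 \<approx> m2 @ gpow r1"
    and m: "m \<in> lists D" "m2 \<in> lists D" using z unfolding p act_iff by blast+
  have "((u @ v) @ m @ gpow r2) @ gpow r1 = u @ (v @ m @ gpow r1) @ gpow r2"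
    by (simp add: gpow_commute)
  also have "\<dots> \<approx> u @ (m1 @ gpow r) @ gpow r2" by (rule pres_cong.ctxt[OF 1])
  also have "\<dots> = (u @ m1 @ gpow r2) @ gpow r" by (simp add: gpow_commute)
  also have "\<dots> \<approx> (m2 @ gpow r1) @ gpow r" by (rule cng_append_gpow[OF 2])
  also have "\<dots> = (m2 @ gpow r) @ gpow r1" by (simp add: gpow_commute)
  finally have "(u @ v) @ m @ gpow r2 \<approx> m2 @ gpow r"
    by (rule gpow_cancel) (intro closed_append D m gpow_closed)+
  then show "(p, q) \<in> act (u @ v)" unfolding p act_iff using m by blast
next
  fix p q assume a: "(p, q) \<in> act (u @ v)"
  obtain m r m2 r2 where p: "p = (m, r)" "q = (m2, r2)" by (metis surj_pair)
  have m: "m \<in> lists D" "m2 \<in> lists D" "(u @ v) @ m @ gpow r2 \<approx> m2 @ gpow r"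
    using a unfolding p act_iff by blast+
  \<comment> \<open>\<open>v @ m\<close> over the unchanged denominator is \<open>v\<close> times
    the fraction \<open>(m, r)\<close>.\<close>
  have "(p, (v @ m, r)) \<in> act v" "((v @ m, r), q) \<in> act u"
    unfolding p act_iff using m closed_append[OF D(2) m(1)] by auto
  then show "(p, q) \<in> act v O act u" by blast
qed

text \<open>Left multiplication by \<open>u\<close> is defined on every fraction and, by left
  cancellation, injective up to equality of fractions.\<close>

lemma act_converse_right:
  assumes D: "u \<in> lists D"
  shows "act u O (act u)\<inverse> = act []"
proof (intro equalityI subrelI)
  fix p q assume "(p, q) \<in> act u O (act u)\<inverse>"
  then obtain z where z: "(p, z) \<in> act u" "(q, z) \<in> act u" by blast
  obtain m r m1 r1 m2 r2 where p: "p = (m, r)" "z = (m1, r1)" "q = (m2, r2)"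
    by (metis surj_pair)
  have 1: "u @ m @ gpow r1 \<approx> m1 @ gpow r" and 2: "u @ m2 @ gpow r1 \<approx> m1 @ gpow r2"
    and m: "m \<in> lists D" "m2 \<in> lists D" using z unfolding p act_iff by blast+
  have "u @ ((m @ gpow r2) @ gpow r1) = (u @ m @ gpow r1) @ gpow r2" by (simp add: gpow_commute)
  also have "\<dots> \<approx> (m1 @ gpow r) @ gpow r2" by (rule cng_append_gpow[OF 1])
  also have "\<dots> = (m1 @ gpow r2) @ gpow r" by (simp add: gpow_commute)
  also have "\<dots> \<approx> (u @ m2 @ gpow r1) @ gpow r" by (rule cng_append_gpow[OF pres_cong.sym[OF 2]])
  also have "\<dots> = u @ ((m2 @ gpow r) @ gpow r1)" by (simp add: gpow_commute)
  finally have "(m @ gpow r2) @ gpow r1 \<approx> (m2 @ gpow r) @ gpow r1"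
    by (rule left_cancel_append) (intro closed_append D m gpow_closed)+
  then have "m @ gpow r2 \<approx> m2 @ gpow r"
    by (rule gpow_cancel) (intro closed_append m gpow_closed)+
  then show "(p, q) \<in> act []" unfolding p act_iff using m by simp
next
  fix p q assume a: "(p, q) \<in> act []"
  obtain m r m2 r2 where p: "p = (m, r)" "q = (m2, r2)" by (metis surj_pair)
  have m: "m \<in> lists D" "m2 \<in> lists D" "m @ gpow r2 \<approx> m2 @ gpow r"
    using a unfolding p act_iff by auto
  have "u @ m2 @ gpow r \<approx> u @ m @ gpow r2"
    by (rule pres_cong_append[OF cng_refl pres_cong.sym[OF m(3)]])
  then have "(p, (u @ m, r)) \<in> act u" "(q, (u @ m, r)) \<in> act u"
    unfolding p act_iff using m closed_append[OF D m(1)] by auto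
  then show "(p, q) \<in> act u O (act u)\<inverse>" by blast
qed

text \<open>The point is surjectivity. If \<open>x y = g\<close> and \<open>m g = g v\<close>, then
  \<open>x\<close> times the fraction with numerator \<open>y v\<close> and exponent
  \<open>r + 1\<close> has numerator \<open>g v = m g\<close>, so it equals the fraction
  \<open>(m, r)\<close>.\<close>

lemma act_converse_left:
  assumes x: "x \<in> D"
  shows "(act [x])\<inverse> O act [x] = act []"
proof (intro equalityI subrelI)
  fix p q assume "(p, q) \<in> (act [x])\<inverse> O act [x]"
  then obtain z where z: "(z, p) \<in> act [x]" "(z, q) \<in> act [x]" by blast
  obtain m r m1 r1 m2 r2 where p: "p = (m, r)" "z = (m1, r1)" "q = (m2, r2)"
    by (metis surj_pair)
  have 1: "[x] @ m1 @ gpow r \<approx> m @ gpow r1" and 2: "[x] @ m1 @ gpow r2 \<approx> m2 @ gpow r1"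
    and m: "m \<in> lists D" "m2 \<in> lists D" using z unfolding p act_iff by blast+
  have "(m @ gpow r2) @ gpow r1 = (m @ gpow r1) @ gpow r2" by (simp add: gpow_commute)
  also have "\<dots> \<approx> ([x] @ m1 @ gpow r) @ gpow r2" by (rule cng_append_gpow[OF pres_cong.sym[OF 1]])
  also have "\<dots> = ([x] @ m1 @ gpow r2) @ gpow r" by (simp add: gpow_commute)
  also have "\<dots> \<approx> (m2 @ gpow r1) @ gpow r" by (rule cng_append_gpow[OF 2])
  also have "\<dots> = (m2 @ gpow r) @ gpow r1" by (simp add: gpow_commute)
  finally have "m @ gpow r2 \<approx> m2 @ gpow r"
    by (rule gpow_cancel) (intro closed_append m gpow_closed)+
  then show "(p, q) \<in> act []" unfolding p act_iff using m by simp
next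
  fix p q assume a: "(p, q) \<in> act []"
  obtain m r where p: "p = (m, r)" by (metis surj_pair)
  have m: "m \<in> lists D" using a unfolding p act_def by auto
  obtain v where v: "v \<in> lists D" "m @ [g] \<approx> g # v" using g_commute[OF m] by blast
  obtain y where y: "P x y g" using P_g[OF x] by blast
  have "[x] @ (y # v) @ gpow r = [] @ [x, y] @ (v @ gpow r)" by simp
  also have "\<dots> \<approx> [] @ [g] @ (v @ gpow r)"
    by (rule pres_cong.ctxt[OF pres_cong.sym[OF cng_product[OF y]]])
  also have "\<dots> = (g # v) @ gpow r" by simp
  also have "\<dots> \<approx> (m @ [g]) @ gpow r" by (rule cng_append_gpow[OF pres_cong.sym[OF v(2)]])
  finally have "((y # v, Suc r), p) \<in> act [x]"
    unfolding p act_iff using m v(1) P_closed[OF y] by simp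
  moreover from this a have "((y # v, Suc r), q) \<in> act [x]"
    using act_comp[of "[]" "[x]"] x by auto
  ultimately show "(p, q) \<in> (act [x])\<inverse> O act [x]" by blast
qed

section \<open>The action of the presented group on fractions\<close>

lemma act_Nil_converse: "(act [])\<inverse> = act []"
  unfolding act_def by (auto intro: pres_cong.sym)

text \<open>Contexts in a congruence may contain letters outside \<open>D\<close>. They get the
  empty relation, which absorbs \<open>act []\<close> on the right as the other letter relations
  do.\<close>

fun letter_act where
  "letter_act (x, s) = (if x \<in> D then if s then act [x] else (act [x])\<inverse> else {})"

text \<open>Fractions are not normalised, so the empty word acts as \<open>act []\<close>, the
  equality of fractions, instead of the identity relation.\<close>

fun word_act where
  "word_act [] = act []"
| "word_act (y # W) = word_act W O letter_act y"

lemma letter_act_Nil: "letter_act y O act [] = letter_act y"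
proof -
  have "(act [x])\<inverse> O act [] = (act [x])\<inverse>" if "x \<in> D" for x
  proof -
    have "(act [x])\<inverse> O act [] = (act [] O act [x])\<inverse>"
      by (simp add: converse_relcomp act_Nil_converse)
    then show ?thesis using act_comp[of "[x]" "[]"] that by simp
  qed
  then show ?thesis using act_comp[of "[]" "[fst y]"] by (cases y) auto
qed

lemma word_act_Nil: "word_act W O act [] = word_act W"
  using act_comp[of "[]" "[]"] by (cases W) (auto simp: O_assoc letter_act_Nil)

lemma word_act_append: "word_act (V @ W) = word_act W O word_act V"
  by (induction V) (auto simp: word_act_Nil O_assoc)

lemma word_act_positive: "u \<in> lists D \<Longrightarrow> word_act (map (\<lambda>x. (x, True)) u) = act u"
proof (induction u)
  case (Cons x u)
  then show ?case using act_comp[of "[x]" u] by auto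
qed simp

text \<open>Relations of the monoid hold by \<open>act_cong\<close>, and cancellation of formal
  inverses is what the two \<open>act_converse\<close> lemmas provide. Hence the group with the same
  presentation acts on fractions.\<close>

lemma word_act_cong: "pres_cong (pres_group_rels D rels) V W \<Longrightarrow> word_act V = word_act W"
proof (induction rule: pres_cong.induct)
  case (rel V W)
  then consider u v where "V = map (\<lambda>x. (x, True)) u" "W = map (\<lambda>x. (x, True)) v" "(u, v) \<in> rels"
    | x where "x \<in> D" "V = [(x, True), (x, False)]" "W = []"
    | x where "x \<in> D" "V = [(x, False), (x, True)]" "W = []"
    unfolding pres_group_rels_def by blast
  then show ?case
  proof cases
    case 1
    have "u \<approx> v" using 1(3) by (rule pres_cong.rel)
    moreover have "u \<in> lists D" using 1(3) idn_closed P_closed by (auto simp: rels_def)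
    ultimately show ?thesis using 1 act_cong cng_lists_iff by (auto simp: word_act_positive)
  next
    case 2
    then have "word_act V = (act [] O (act [x])\<inverse>) O act [x]" by simp
    also have "act [] O (act [x])\<inverse> = (act [x] O act [])\<inverse>"
      by (simp add: converse_relcomp act_Nil_converse)
    also have "\<dots> = (act [x])\<inverse>" using act_comp[of "[]" "[x]"] 2 by simp
    finally show ?thesis using act_converse_left 2 by simp
  next
    case 3
    then have "word_act V = (act [] O act [x]) O (act [x])\<inverse>" by simp
    also have "act [] O act [x] = act [x]" using act_comp[of "[x]" "[]"] 3 by simp
    finally show ?thesis using act_converse_right 3 by simp
  qed
qed (auto simp: word_act_append)

text \<open>Elements with equal images in the group act equally, and the action on the fraction
  \<open>([], 0)\<close> recovers the element.\<close>

theorem inj_on_frac_map: "inj_on (frac_map D rels) (carrier M)"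
proof (rule inj_onI)
  fix a b assume ab: "a \<in> carrier M" "b \<in> carrier M" "frac_map D rels a = frac_map D rels b"
  have rep: "\<exists>u\<in>lists D. c = cls u \<and>
      frac_map D rels c = pres_class (pres_group_rels D rels) (map (\<lambda>x. (x, True)) u)"
    if c: "c \<in> carrier M" for c
  proof -
    obtain u where u: "u \<in> lists D" "c = cls u" using c by (rule carrier_ME)
    have "(SOME v. v \<in> c) \<in> c" by (rule someI[of _ u]) (simp add: u pres_class_def)
    then have v: "u \<approx> (SOME v. v \<in> c)" using u by (simp add: pres_class_def)
    have "(SOME v. v \<in> c) \<in> lists D" "c = cls (SOME v. v \<in> c)"
      using cng_lists_iff[OF v] u v by (blast, simp add: cls_eq_iff)
    then show ?thesis unfolding frac_map_def by blast
  qed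
  obtain u where u: "u \<in> lists D" "a = cls u"
      "frac_map D rels a = pres_class (pres_group_rels D rels) (map (\<lambda>x. (x, True)) u)"
    using rep[OF ab(1)] by blast
  obtain v where v: "v \<in> lists D" "b = cls v"
      "frac_map D rels b = pres_class (pres_group_rels D rels) (map (\<lambda>x. (x, True)) v)"
    using rep[OF ab(2)] by blast
  have "pres_cong (pres_group_rels D rels) (map (\<lambda>x. (x, True)) u) (map (\<lambda>x. (x, True)) v)"
    using ab(3) u(3) v(3) by (simp add: pres_class_eq_iff)
  then have "act u = act v" using word_act_cong word_act_positive[OF u(1)] word_act_positive[OF v(1)] by blast
  moreover have "(([], 0), (u, 0)) \<in> act u" using u(1) unfolding act_iff by simp
  ultimately have "(([], 0), (u, 0)) \<in> act v" by blast
  then have "v @ [] @ gpow 0 \<approx> u @ gpow 0" unfolding act_iff by blast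
  then have "v \<approx> u" by simp
  then show "a = b" using u v by (simp add: cls_eq_iff pres_cong.sym)
qed

end

subsection \<open>Balanced intervals in a group with a length function\<close>

text \<open>Split off so that \<open>pre\<close> and \<open>D\<close> are available for stating the
  assumptions of \<open>interval_group\<close>.\<close>

locale length_group = group G for G :: "('a, 'b) monoid_scheme" (structure) +
  fixes L :: "'a \<Rightarrow> nat" and g :: 'a
begin

definition pre where "pre u w \<longleftrightarrow> L u + L (inv u \<otimes> w) = L w"

definition D where "D = {w \<in> carrier G. pre w g}"

end

text \<open>By \<open>balanced\<close>, \<open>g\<close> has the same prefixes and suffixes.
  \<open>atom_join\<close> asks for joins of two atoms only; \<open>D_join\<close> extends them to
  all pairs.\<close>

locale interval_group = length_group G L g
  for G :: "('a, 'b) monoid_scheme" (structure) and L :: "'a \<Rightarrow> nat" and g +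
  fixes X :: "'a set" and mir :: "'a \<Rightarrow> 'a"
  assumes X_closed: "X \<subseteq> carrier G"
    and L_one: "L \<one> = 0"
    and L_zero: "w \<in> carrier G \<Longrightarrow> L w = 0 \<Longrightarrow> w = \<one>"
    and L_mult_le: "u \<in> carrier G \<Longrightarrow> w \<in> carrier G \<Longrightarrow> L (u \<otimes> w) \<le> L u + L w"
    and L_atom: "x \<in> X \<Longrightarrow> L x = 1"
    and ex_atom: "w \<in> carrier G \<Longrightarrow> w \<noteq> \<one> \<Longrightarrow> \<exists>x\<in>X. pre x w"
    and g_closed: "g \<in> carrier G"
    and balanced: "w \<in> carrier G \<Longrightarrow> L w + L (inv w \<otimes> g) = L g \<longleftrightarrow> L w + L (g \<otimes> inv w) = L g"
    and finite_D: "finite D"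
    and atom_join: "x \<in> X \<Longrightarrow> y \<in> X \<Longrightarrow> x \<noteq> y \<Longrightarrow>
          \<exists>c\<in>D. pre x c \<and> pre y c \<and> (\<forall>w\<in>D. pre x w \<and> pre y w \<longrightarrow> pre c w)"
    and mir_closed: "w \<in> carrier G \<Longrightarrow> mir w \<in> carrier G"
    and mir_mir: "w \<in> carrier G \<Longrightarrow> mir (mir w) = w"
    and mir_mult: "u \<in> carrier G \<Longrightarrow> w \<in> carrier G \<Longrightarrow> mir (u \<otimes> w) = mir w \<otimes> mir u"
    and L_mir: "w \<in> carrier G \<Longrightarrow> L (mir w) = L w"
    and mir_g: "mir g = g"
begin

section \<open>The prefix order\<close>

lemma inv_cancel: "u \<in> carrier G \<Longrightarrow> w \<in> carrier G \<Longrightarrow> u \<otimes> (inv u \<otimes> w) = w"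
  "u \<in> carrier G \<Longrightarrow> w \<in> carrier G \<Longrightarrow> inv u \<otimes> (u \<otimes> w) = w"
  by (simp_all flip: m_assoc)

lemma pre_mult_iff:
  "u \<in> carrier G \<Longrightarrow> w \<in> carrier G \<Longrightarrow> pre u (u \<otimes> w) \<longleftrightarrow> L (u \<otimes> w) = L u + L w"
  unfolding pre_def by (auto simp: inv_cancel)

lemma preE:
  assumes "pre u w" "u \<in> carrier G" "w \<in> carrier G"
  obtains v where "v \<in> carrier G" "w = u \<otimes> v" "L w = L u + L v"
proof (rule that)
  show "inv u \<otimes> w \<in> carrier G" "w = u \<otimes> (inv u \<otimes> w)" "L w = L u + L (inv u \<otimes> w)"
    using assms by (auto simp: pre_def inv_cancel)
qed

lemma pre_refl: "u \<in> carrier G \<Longrightarrow> pre u u"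
  unfolding pre_def by (simp add: L_one)

lemma pre_one: "u \<in> carrier G \<Longrightarrow> pre \<one> u"
  unfolding pre_def by (simp add: L_one)

text \<open>Subadditivity leaves no slack: a loss of length in a pair of adjacent factors could not
  be regained in the triple product.\<close>

lemma pre_split:
  assumes G: "z \<in> carrier G" "a \<in> carrier G" "b \<in> carrier G"
    and L: "L (z \<otimes> a \<otimes> b) = L z + L a + L b"
  shows "L (z \<otimes> a) = L z + L a" "L (a \<otimes> b) = L a + L b"
proof -
  have "L (z \<otimes> (a \<otimes> b)) \<le> L z + L (a \<otimes> b)" using G L_mult_le by simp
  then show "L (a \<otimes> b) = L a + L b" using L L_mult_le[of a b] G by (simp add: m_assoc)
  have "L (z \<otimes> a \<otimes> b) \<le> L (z \<otimes> a) + L b" using G L_mult_le by simp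
  then show "L (z \<otimes> a) = L z + L a" using L L_mult_le[of z a] G by simp
qed

lemma pre_trans:
  assumes "pre u v" "pre v w" and G: "u \<in> carrier G" "v \<in> carrier G" "w \<in> carrier G"
  shows "pre u w"
proof -
  obtain a where a: "a \<in> carrier G" "v = u \<otimes> a" "L v = L u + L a" using assms by (elim preE)
  obtain b where b: "b \<in> carrier G" "w = v \<otimes> b" "L w = L v + L b" using assms by (elim preE)
  have "L (a \<otimes> b) = L a + L b" using pre_split(2)[of u a b] a b G by simp
  then have "pre u (u \<otimes> (a \<otimes> b))" using a b G by (subst pre_mult_iff) (auto simp: m_assoc)
  then show ?thesis using a b G by (simp add: m_assoc)
qed

text \<open>The left quotient of \<open>z \<otimes> b\<close> by \<open>z \<otimes> a\<close> does
  not involve \<open>z\<close>. So translation by \<open>z\<close> preserves the order where lengths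
  add up, which reduces joins above \<open>z\<close> to joins of atoms.\<close>

lemma pre_shift:
  assumes "z \<in> carrier G" "a \<in> carrier G" "b \<in> carrier G"
    and "pre z (z \<otimes> a)" "pre z (z \<otimes> b)"
  shows "pre (z \<otimes> a) (z \<otimes> b) \<longleftrightarrow> pre a b"
proof -
  have "inv (z \<otimes> a) \<otimes> (z \<otimes> b) = inv a \<otimes> b"
    using assms by (simp add: inv_mult_group m_assoc inv_cancel)
  then show ?thesis using assms by (simp add: pre_mult_iff) (simp add: pre_def)
qed

lemma pre_mid:
  assumes "z \<in> carrier G" "x \<in> carrier G" "u \<in> carrier G" "pre z u" "pre x (inv z \<otimes> u)"
  shows "pre z (z \<otimes> x)" "pre (z \<otimes> x) u"
proof -
  let ?u = "inv z \<otimes> u"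
  obtain b where b: "b \<in> carrier G" "?u = x \<otimes> b" "L ?u = L x + L b"
    using assms by (elim preE) auto
  have u: "u = z \<otimes> ?u" "L u = L z + L ?u" using assms by (auto simp: inv_cancel pre_def)
  then have "u = z \<otimes> x \<otimes> b" using b assms by (simp add: m_assoc)
  then have *: "L (z \<otimes> x) = L z + L x" using pre_split(1)[of z x b] assms b u by simp
  then show z: "pre z (z \<otimes> x)" using assms by (simp add: pre_mult_iff)
  show "pre (z \<otimes> x) u"
    using pre_shift[of z x ?u] z assms u(1) by simp
qed

lemma D_closed: "w \<in> D \<Longrightarrow> w \<in> carrier G"
  by (simp add: D_def)

lemma g_in_D: "g \<in> D"
  using g_closed pre_refl by (simp add: D_def)

lemma D_prefix: "pre u w \<Longrightarrow> u \<in> carrier G \<Longrightarrow> w \<in> D \<Longrightarrow> u \<in> D"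
  unfolding D_def using pre_trans g_closed by blast

text \<open>By \<open>balanced\<close> the product \<open>u \<otimes> w\<close> is also a suffix of
  \<open>g\<close>, with left cofactor \<open>?z\<close>. Subadditivity then makes \<open>w\<close>
  a suffix of \<open>g\<close> with left cofactor \<open>?z \<otimes> u\<close>, and
  \<open>balanced\<close> turns the suffix back into a prefix.\<close>

lemma D_suffix:
  assumes "u \<in> carrier G" "w \<in> carrier G" "u \<otimes> w \<in> D" "L (u \<otimes> w) = L u + L w"
  shows "w \<in> D"
proof -
  let ?z = "g \<otimes> inv (u \<otimes> w)"
  have z: "?z \<in> carrier G" using assms g_closed by simp
  have "L (u \<otimes> w) + L ?z = L g"
    using balanced[of "u \<otimes> w"] assms by (simp add: D_def pre_def)
  moreover have zu: "?z \<otimes> u = g \<otimes> inv w"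
  proof -
    have "?z \<otimes> u = g \<otimes> (inv w \<otimes> (inv u \<otimes> u))"
      using assms g_closed by (simp add: inv_mult_group m_assoc del: l_inv)
    then show ?thesis using assms by simp
  qed
  moreover have "g \<otimes> inv w \<otimes> w = g" using assms g_closed by (simp add: m_assoc)
  ultimately have "L w + L (g \<otimes> inv w) = L g"
    using L_mult_le[of ?z u] L_mult_le[of "g \<otimes> inv w" w] assms g_closed z by simp
  then show ?thesis using balanced assms by (simp add: D_def pre_def)
qed

lemma D_cofactor: "pre u w \<Longrightarrow> u \<in> carrier G \<Longrightarrow> w \<in> D \<Longrightarrow> inv u \<otimes> w \<in> D"
  using D_suffix[of u "inv u \<otimes> w"] D_closed by (auto simp: inv_cancel pre_def)

text \<open>Bjorner, Edelman and Ziegler: it suffices to join two elements covering a common element \<open>z\<close>,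
  and translation by \<open>z\<close> reduces this to two atoms.\<close>

lemma D_join_above:
  assumes "z \<in> D" "u \<in> D" "v \<in> D" "pre z u" "pre z v"
  shows "\<exists>m\<in>D. pre u m \<and> pre v m \<and> (\<forall>t\<in>D. pre u t \<and> pre v t \<longrightarrow> pre m t)"
  using assms
\<comment> \<open>Each use of the hypothesis moves the base point from \<open>z\<close> to some
  \<open>z \<otimes> x\<close>, longer by one but still of length at most
  \<open>L g\<close>.\<close>
proof (induction "L g - L z" arbitrary: z u v rule: less_induct)
  case less
  note zuv = less.prems and G = D_closed[OF less.prems(1)] D_closed[OF less.prems(2)]
    D_closed[OF less.prems(3)]
  have IH: "\<exists>m\<in>D. pre u' m \<and> pre v' m \<and> (\<forall>t\<in>D. pre u' t \<and> pre v' t \<longrightarrow> pre m t)"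
    if "x \<in> X" "z \<otimes> x \<in> D" "pre z (z \<otimes> x)" "u' \<in> D" "v' \<in> D" "pre (z \<otimes> x) u'" "pre (z \<otimes> x) v'"
    for x u' v'
  proof -
    have x: "x \<in> carrier G" using that X_closed by blast
    have "L (z \<otimes> x) = L z + 1" using that x G L_atom by (simp add: pre_mult_iff)
    moreover have "L (z \<otimes> x) \<le> L g" using that by (auto simp: D_def pre_def)
    ultimately show ?thesis using less.hyps[of "z \<otimes> x" u' v'] that by simp
  qed
  have atom: "\<exists>x\<in>X. pre x (inv z \<otimes> w)" if "w \<in> D" "w \<noteq> z" for w
  proof -
    have "inv z \<otimes> w \<noteq> \<one>"
      using that G D_closed inv_cancel(1)[of z w] by auto
    then show ?thesis using ex_atom that D_closed G by simp
  qed
  consider "u = z" | "v = z" | "u \<noteq> z" "v \<noteq> z" by blast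
  then show ?case
  proof cases
    case 1
    then show ?thesis using zuv G pre_refl by (intro bexI[of _ v]) auto
  next
    case 2
    then show ?thesis using zuv G pre_refl by (intro bexI[of _ u]) auto
  next
    case 3
    obtain x where x: "x \<in> X" "pre x (inv z \<otimes> u)" using atom zuv 3 by blast
    obtain y where y: "y \<in> X" "pre y (inv z \<otimes> v)" using atom zuv 3 by blast
    have xyG: "x \<in> carrier G" "y \<in> carrier G" using x y X_closed by auto
    note zx = pre_mid[OF G(1) xyG(1) G(2) zuv(4) x(2)]
    note zy = pre_mid[OF G(1) xyG(2) G(3) zuv(5) y(2)]
    have zxD: "z \<otimes> x \<in> D" using D_prefix zx(2) zuv(2) G xyG by blast
    have zyD: "z \<otimes> y \<in> D" using D_prefix zy(2) zuv(3) G xyG by blast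
    show ?thesis
    proof (cases "x = y")
      case True
      then show ?thesis using IH[OF x(1) zxD zx(1) zuv(2,3) zx(2)] zy by simp
    next
      case False
      obtain c where c: "c \<in> D" "pre x c" "pre y c" "\<forall>w\<in>D. pre x w \<and> pre y w \<longrightarrow> pre c w"
        using atom_join[OF x(1) y(1) False] by blast
      have cG: "c \<in> carrier G" using c D_closed by blast
      \<comment> \<open>Dividing \<open>t\<close> by \<open>z\<close> stays in \<open>D\<close> and
        gives an element above both atoms \<open>x\<close> and \<open>y\<close>, hence above their
        join \<open>c\<close>.\<close>
      have zt: "pre z (z \<otimes> c) \<and> pre (z \<otimes> c) t"
        if t: "t \<in> D" "pre z t" "pre (z \<otimes> x) t" "pre (z \<otimes> y) t" for t
      proof -
        let ?t = "inv z \<otimes> t"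
        have tG: "t \<in> carrier G" "?t \<in> carrier G" using t G D_closed by auto
        have "pre x ?t" "pre y ?t"
          using pre_shift[of z x ?t] pre_shift[of z y ?t] t zx(1) zy(1) G tG xyG
          by (auto simp: inv_cancel)
        then have "pre c ?t" using c(4) D_cofactor t G by blast
        then show ?thesis using pre_mid[of z c t] t G tG cG by blast
      qed
      \<comment> \<open>\<open>g\<close> lies above all of \<open>D\<close>, so the case
        \<open>t = g\<close> places \<open>z \<otimes> c\<close> in the interval.\<close>
      have "pre z g" "pre (z \<otimes> x) g" "pre (z \<otimes> y) g"
        using zuv(1) zxD zyD by (auto simp: D_def)
      then have zc: "pre z (z \<otimes> c)" "pre (z \<otimes> c) g" using zt[OF g_in_D] by auto
      have zcD: "z \<otimes> c \<in> D" using zc(2) G cG by (simp add: D_def)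
      have zxc: "pre (z \<otimes> x) (z \<otimes> c)" "pre (z \<otimes> y) (z \<otimes> c)"
        using pre_shift G cG xyG zx(1) zy(1) zc c by auto
      \<comment> \<open>\<open>u\<close> and \<open>z \<otimes> c\<close> share the lower bound
        \<open>z \<otimes> x\<close>, and afterwards \<open>v\<close> and \<open>m1\<close> share
        \<open>z \<otimes> y\<close>. Both pairs are within reach of the induction
        hypothesis.\<close>
      obtain m1 where m1: "m1 \<in> D" "pre u m1" "pre (z \<otimes> c) m1"
          "\<forall>t\<in>D. pre u t \<and> pre (z \<otimes> c) t \<longrightarrow> pre m1 t"
        using IH[OF x(1) zxD zx(1) zuv(2) zcD zx(2) zxc(1)] by blast
      have "pre (z \<otimes> y) m1" using pre_trans[OF zxc(2) m1(3)] D_closed zyD zcD m1(1) by blast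
      then obtain m where m: "m \<in> D" "pre v m" "pre m1 m" "\<forall>t\<in>D. pre v t \<and> pre m1 t \<longrightarrow> pre m t"
        using IH[OF y(1) zyD zy(1) zuv(3) m1(1) zy(2)] by blast
      have "pre u m" using pre_trans[OF m1(2) m(3)] G D_closed m1(1) m(1) by blast
      moreover have "pre m t" if t: "t \<in> D" "pre u t" "pre v t" for t
      proof -
        have tG: "t \<in> carrier G" using t D_closed by blast
        have "pre z t" "pre (z \<otimes> x) t" "pre (z \<otimes> y) t"
          using pre_trans[OF zuv(4) t(2)] pre_trans[OF zx(2) t(2)] pre_trans[OF zy(2) t(3)]
            G xyG tG by auto
        then have "pre (z \<otimes> c) t" using zt t by blast
        then show ?thesis using m1(4) m(4) t by blast
      qed
      ultimately show ?thesis using m by blast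
    qed
  qed
qed

lemma D_join:
  assumes "u \<in> D" "v \<in> D"
  shows "\<exists>m\<in>D. pre u m \<and> pre v m \<and> (\<forall>t\<in>D. pre u t \<and> pre v t \<longrightarrow> pre m t)"
proof -
  have "\<one> \<in> D" using pre_one g_closed by (simp add: D_def)
  then show ?thesis using D_join_above assms pre_one D_closed by blast
qed

section \<open>Mirror images and the germ of the interval\<close>

lemma mir_inv: assumes "w \<in> carrier G" shows "mir (inv w) = inv (mir w)"
proof -
  have 1: "mir \<one> = \<one>" using mir_mult[of "\<one>" "\<one>"] mir_closed[of "\<one>"] by simp
  have "mir w \<otimes> mir (inv w) = \<one>" using mir_mult[of "inv w" w] assms 1 by simp
  then show ?thesis using assms mir_closed inv_equality inv_comm by (metis inv_closed)
qed

text \<open>\<open>mir\<close> turns prefixes of \<open>g\<close> into suffixes of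
  \<open>mir g = g\<close>, and \<open>balanced\<close> turns these back into prefixes.\<close>

lemma mir_D: assumes "w \<in> D" shows "mir w \<in> D"
proof -
  have w: "w \<in> carrier G" using assms by (simp add: D_def)
  have "mir (inv w \<otimes> g) = g \<otimes> inv (mir w)"
    using w g_closed mir_mult mir_inv mir_g by simp
  then have "L (g \<otimes> inv (mir w)) = L (inv w \<otimes> g)" using L_mir[of "inv w \<otimes> g"] w g_closed by simp
  then show ?thesis
    using assms w balanced[of "mir w"] mir_closed L_mir by (simp add: D_def pre_def)
qed

definition P where "P a b c \<longleftrightarrow> a \<in> D \<and> b \<in> D \<and> c \<in> D \<and> c = a \<otimes> b \<and> L c = L a + L b"

lemma ex_P_iff: assumes "u \<in> D" "w \<in> D" shows "(\<exists>v. P u v w) \<longleftrightarrow> pre u w"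
proof
  assume "\<exists>v. P u v w"
  then show "pre u w" using D_closed pre_mult_iff by (auto simp: P_def)
next
  assume "pre u w"
  then have "P u (inv u \<otimes> w) w"
    using D_cofactor assms D_closed by (auto simp: P_def inv_cancel pre_def)
  then show "\<exists>v. P u v w" by blast
qed

sublocale germ: garside_germ D P \<one> L g mir
proof
  show "\<one> \<in> D" using pre_one g_closed by (simp add: D_def)
  then show "P \<one> a a" "P a \<one> a" if "a \<in> D" for a
    using that D_closed by (auto simp: P_def L_one)
  show "b = b'" if "P a b c" "P a b' c" for a b b' c
    using that D_closed by (auto simp: P_def)
  show "\<exists>bc. P b c bc \<and> P a bc abc" if "P a b ab" "P ab c abc" for a b ab c abc
  proof -
    have G: "a \<in> carrier G" "b \<in> carrier G" "c \<in> carrier G" using that D_closed by (auto simp: P_def)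
    have "L (b \<otimes> c) = L b + L c" using pre_split(2)[OF G] that by (auto simp: P_def)
    moreover from this have "b \<otimes> c \<in> D"
      using D_suffix[of a "b \<otimes> c"] that G by (auto simp: P_def m_assoc)
    ultimately show ?thesis using that G by (intro exI[of _ "b \<otimes> c"]) (auto simp: P_def m_assoc)
  qed
  show "\<exists>ab. P a b ab \<and> P ab c abc" if "P b c bc" "P a bc abc" for a b c bc abc
  proof -
    have G: "a \<in> carrier G" "b \<in> carrier G" "c \<in> carrier G" using that D_closed by (auto simp: P_def)
    have L: "L (a \<otimes> b) = L a + L b" using pre_split(1)[OF G] that G by (auto simp: P_def m_assoc)
    have "pre (a \<otimes> b) (a \<otimes> b \<otimes> c)"
      using that G L by (subst pre_mult_iff) (auto simp: P_def m_assoc)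
    then have "a \<otimes> b \<in> D" using D_prefix[of "a \<otimes> b" abc] that G by (auto simp: P_def m_assoc)
    then show ?thesis using that G L by (intro exI[of _ "a \<otimes> b"]) (auto simp: P_def m_assoc)
  qed
  show "L a = 0 \<longleftrightarrow> a = \<one>" if "a \<in> D" for a
    using that L_zero L_one D_closed by blast
  show "\<exists>m x y. P u x m \<and> P v y m \<and> (\<forall>m' x' y'. P u x' m' \<and> P v y' m' \<longrightarrow> (\<exists>z. P m z m'))"
    if uv: "u \<in> D" "v \<in> D" for u v
  proof -
    obtain m where m: "m \<in> D" "pre u m" "pre v m" "\<forall>t\<in>D. pre u t \<and> pre v t \<longrightarrow> pre m t"
      using D_join[OF uv] by blast
    have "\<exists>z. P m z m'" if "P u x' m'" "P v y' m'" for m' x' y'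
    proof -
      have m': "m' \<in> D" using that unfolding P_def by blast
      have "pre u m'" "pre v m'" using that ex_P_iff[OF uv(1) m'] ex_P_iff[OF uv(2) m'] by blast+
      then show ?thesis using m(4) m' ex_P_iff[OF m(1) m'] by blast
    qed
    moreover obtain x y where "P u x m" "P v y m"
      using m ex_P_iff[OF uv(1) m(1)] ex_P_iff[OF uv(2) m(1)] by blast
    ultimately show ?thesis by blast
  qed
  show "\<exists>b. P a b g" if "a \<in> D" for a
    using that ex_P_iff g_in_D by (auto simp: D_def)
  show "P (mir b) (mir a) (mir c)" if "P a b c" for a b c
  proof -
    have "mir c = mir b \<otimes> mir a" using that mir_mult D_closed by (auto simp: P_def)
    moreover have "L (mir c) = L (mir b) + L (mir a)"
      using that L_mir D_closed unfolding P_def by (metis add.commute)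
    ultimately show ?thesis using that mir_D unfolding P_def by blast
  qed
qed (use finite_D g_in_D mir_D mir_mir mir_g D_closed in \<open>auto simp: P_def\<close>)

end

subsection \<open>Lengths in \<open>G(e,e,n)\<close>\<close>

definition rcol :: "complex mat \<Rightarrow> nat \<Rightarrow> nat" where
  "rcol A i = (THE j. j < dim_col A \<and> A $$ (i, j) \<noteq> 0)"

definition rval :: "complex mat \<Rightarrow> nat \<Rightarrow> complex" where
  "rval A i = A $$ (i, rcol A i)"

definition sw :: "nat \<Rightarrow> nat \<Rightarrow> nat" where
  "sw p i = (if i = p then Suc p else if i = Suc p then p else i)"

text \<open>Common form of all generators: acting from the left, it exchanges rows \<open>p\<close>
  and \<open>p + 1\<close> and scales the new rows by \<open>inverse c\<close> and
  \<open>c\<close>.\<close>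

definition gen :: "nat \<Rightarrow> nat \<Rightarrow> complex \<Rightarrow> complex mat" where
  "gen n p c = mat n n (\<lambda>(a, b). if a = p \<and> b = Suc p then inverse c
     else if a = Suc p \<and> b = p then c
     else if a = b \<and> a \<noteq> p \<and> a \<noteq> Suc p then 1 else 0)"

definition pairs :: "nat \<Rightarrow> (nat \<times> nat) set" where
  "pairs n = {(j, i). j < i \<and> i < n}"

definition cost :: "complex mat \<Rightarrow> nat \<Rightarrow> nat \<Rightarrow> nat" where
  "cost A j i = (if rcol A i < rcol A j then 1 else if rval A i = 1 then 0 else 2)"

definition ell :: "nat \<Rightarrow> complex mat \<Rightarrow> nat" where
  "ell n A = (\<Sum>(j, i)\<in>pairs n. cost A j i)"

text \<open>\<open>desc p c A\<close> says that the generator acting on rows \<open>p\<close> and \<open>p + 1\<close> shortens \<open>A\<close> from the left;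
  see \<open>ell_desc\<close>.\<close>

definition desc :: "nat \<Rightarrow> complex \<Rightarrow> complex mat \<Rightarrow> bool" where
  "desc p c A \<longleftrightarrow> (rcol A (Suc p) < rcol A p \<and> c * rval A p = 1) \<or>
                 (rcol A p < rcol A (Suc p) \<and> rval A (Suc p) \<noteq> 1)"

lemma sw_sw [simp]: "sw p (sw p i) = i"
  by (simp add: sw_def)

lemma sw_less: "Suc p < n \<Longrightarrow> i < n \<Longrightarrow> sw p i < n"
  by (auto simp: sw_def)

lemma finite_pairs: "finite (pairs n)"
  by (rule finite_subset[of _ "{..<n} \<times> {..<n}"]) (auto simp: pairs_def)

lemma index_mult_mat_sum:
  assumes "A \<in> carrier_mat n n" "B \<in> carrier_mat n n" "i < n" "j < n"
  shows "(A * B) $$ (i, j) = (\<Sum>l<n. A $$ (i, l) * B $$ (l, j))"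
  using assms by (auto simp: times_mat_def scalar_prod_def atLeast0LessThan intro!: sum.cong)

definition gcoef :: "nat \<Rightarrow> complex \<Rightarrow> nat \<Rightarrow> complex" where
  "gcoef p c i = (if i = p then inverse c else if i = Suc p then c else 1)"

lemma gen_index:
  assumes "i < n" "j < n"
  shows "gen n p c $$ (i, j) = (if j = sw p i then gcoef p c i else 0)"
proof -
  consider "i = p" | "i = Suc p" | "i \<noteq> p" "i \<noteq> Suc p" by blast
  then show ?thesis
  proof cases
    case 1
    then show ?thesis using assms by (simp add: gen_def sw_def gcoef_def)
  next
    case 2
    then show ?thesis using assms by (simp add: gen_def sw_def gcoef_def)
  next
    case 3
    then show ?thesis using assms by (simp add: gen_def sw_def gcoef_def eq_commute)
  qed
qed

lemma gcoef_sw: "c \<noteq> 0 \<Longrightarrow> gcoef p c i * gcoef p c (sw p i) = 1"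
  by (simp add: gcoef_def sw_def)

lemma gen_carrier [simp]: "gen n p c \<in> carrier_mat n n"
  by (simp add: gen_def)

lemma gen_mult_index:
  assumes A: "A \<in> carrier_mat n n" and p: "Suc p < n" and ij: "i < n" "j < n"
  shows "(gen n p c * A) $$ (i, j) =
    gcoef p c i * A $$ (sw p i, j)"
proof -
  have "(gen n p c * A) $$ (i, j) = (\<Sum>l<n. gen n p c $$ (i, l) * A $$ (l, j))"
    using A ij by (intro index_mult_mat_sum) auto
  also have "\<dots> = (\<Sum>l<n. if l = sw p i
      then gcoef p c i * A $$ (l, j) else 0)"
    using ij by (intro sum.cong) (auto simp: gen_index)
  also have "\<dots> = gcoef p c i * A $$ (sw p i, j)"
    using sw_less[OF p ij(1)] by (subst sum.delta) auto
  finally show ?thesis .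
qed

lemma gen_gen: assumes "Suc p < n" "c \<noteq> 0" shows "gen n p c * gen n p c = 1\<^sub>m n"
proof (rule eq_matI)
  fix i j assume "i < dim_row (1\<^sub>m n :: complex mat)" "j < dim_col (1\<^sub>m n :: complex mat)"
  then have ij: "i < n" "j < n" by auto
  show "(gen n p c * gen n p c) $$ (i, j) = 1\<^sub>m n $$ (i, j)"
    unfolding gen_mult_index[OF gen_carrier assms(1) ij] gen_index[OF sw_less[OF assms(1) ij(1)] ij(2)]
    using ij gcoef_sw[OF assms(2)] by simp
qed (auto simp: gen_def)

lemma gen_transpose: assumes "c \<noteq> 0" shows "transpose_mat (gen n p c) = gen n p (inverse c)"
  using assms by (intro eq_matI) (auto simp: gen_def)

text \<open>Counting up from row \<open>0\<close> gives \<open>i \<le> f i\<close>; counting down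
  from \<open>f (n - 1) < n\<close> gives \<open>f i \<le> i\<close>.\<close>

lemma strictly_increasing_eq_id:
  fixes f :: "nat \<Rightarrow> nat"
  assumes lt: "\<And>i. i < n \<Longrightarrow> f i < n" and inc: "\<And>i. Suc i < n \<Longrightarrow> f i < f (Suc i)" and i: "i < n"
  shows "f i = i"
proof -
  have "i < n \<longrightarrow> i \<le> f i" for i
  proof (induction i)
    case (Suc i)
    then show ?case using inc[of i] by auto
  qed simp
  moreover have "i + d < n \<longrightarrow> f i + d \<le> f (i + d)" for d
  proof (induction d)
    case (Suc d)
    then show ?case using inc[of "i + d"] by auto
  qed simp
  from this[of "n - 1 - i"] have "f i \<le> i" using lt[of "n - 1"] i by auto
  ultimately show ?thesis using i by (simp add: le_antisym)
qed

lemma cis_eq_zeta_power: "cis (2 * pi * real i / real e) = zeta e ^ i"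
  unfolding zeta_def DeMoivre by (simp add: field_simps)

lemma roots_unity_iff: assumes "e > 0" shows "c ^ e = 1 \<longleftrightarrow> (\<exists>i<e. c = zeta e ^ i)"
proof -
  have "{z. z ^ e = 1} = (\<lambda>i. zeta e ^ i) ` {..<e}"
    using bij_betw_roots_unity[OF assms] by (simp add: bij_betw_def cis_eq_zeta_power)
  then show ?thesis by blast
qed

lemma zeta_power_neq_1: assumes "0 < k" "k < e" shows "zeta e ^ k \<noteq> 1"
proof -
  have "inj_on (\<lambda>i. zeta e ^ i) {..<e}"
    using bij_betw_roots_unity[of e] assms by (simp add: bij_betw_def cis_eq_zeta_power)
  from inj_onD[OF this, of k 0] show ?thesis using assms by auto
qed

lemma zeta_power_e: "e > 0 \<Longrightarrow> zeta e ^ e = 1"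
  unfolding zeta_def DeMoivre by simp

lemma assoc_n:
  fixes A :: "complex mat"
  assumes "A \<in> carrier_mat n n" "B \<in> carrier_mat n n" "C \<in> carrier_mat n n"
  shows "A * B * C = A * (B * C)"
  by (rule assoc_mult_mat[OF assms])

locale geen =
  fixes e n :: nat
  assumes e: "e \<ge> 2" and n: "n \<ge> 2"
begin

abbreviation G where "G \<equiv> Geen e n"

text \<open>Row \<open>p = 0\<close> gives the generators \<open>t\<^sub>i\<close> with \<open>c = zeta e ^ i\<close>, and \<open>p > 0\<close> gives \<open>s\<^sub>j\<close> with \<open>j = p + 2\<close>.\<close>

definition is_gen :: "nat \<Rightarrow> complex \<Rightarrow> bool" where
  "is_gen p c \<longleftrightarrow> Suc p < n \<and> (if p = 0 then c ^ e = 1 else c = 1)"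

lemma is_gen_neq_0: "is_gen p c \<Longrightarrow> c \<noteq> 0"
  using e by (auto simp: is_gen_def power_0_left split: if_splits)

lemma is_gen_power: "is_gen p c \<Longrightarrow> c ^ e = 1"
  by (auto simp: is_gen_def split: if_splits)

lemma Xgens_eq: "Xgens e n = {gen n p c | p c. is_gen p c}"
proof -
  have t: "tgen e n i = gen n 0 (zeta e ^ i)" for i
    unfolding tgen_def gen_def
    by (intro cong_mat) (auto simp: power_int_minus)
  have s: "sgen n (p + 2) = gen n p 1" if "p \<ge> 1" for p
    unfolding sgen_def gen_def by (intro cong_mat) auto
  have "{tgen e n i | i. i < e} = {gen n 0 c | c. c ^ e = 1}"
    unfolding t using e by (subst roots_unity_iff) auto
  moreover have "{sgen n j | j. 3 \<le> j \<and> j \<le> n} = {gen n p 1 | p. 1 \<le> p \<and> Suc p < n}"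
  proof (intro equalityI subsetI)
    fix x assume "x \<in> {sgen n j | j. 3 \<le> j \<and> j \<le> n}"
    then obtain j where j: "3 \<le> j" "j \<le> n" "x = sgen n j" by blast
    have "j - 2 + 2 = j" using j by simp
    then have "x = gen n (j - 2) 1" using s[of "j - 2"] j by simp
    then show "x \<in> {gen n p 1 | p. 1 \<le> p \<and> Suc p < n}"
      using j by (intro CollectI exI[of _ "j - 2"]) auto
  next
    fix x assume "x \<in> {gen n p 1 | p. 1 \<le> p \<and> Suc p < n}"
    then obtain p where "1 \<le> p" "Suc p < n" "x = gen n p 1" by blast
    then show "x \<in> {sgen n j | j. 3 \<le> j \<and> j \<le> n}" using s[of p]
      by (intro CollectI exI[of _ "p + 2"]) auto
  qed
  moreover have "{gen n p c | p c. is_gen p c} =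
      {gen n 0 c | c. c ^ e = 1} \<union> {gen n p 1 | p. 1 \<le> p \<and> Suc p < n}" (is "?X = ?T \<union> ?S")
  proof (intro equalityI subsetI)
    fix x assume "x \<in> ?X"
    then obtain p c where "x = gen n p c" "is_gen p c" by blast
    then show "x \<in> ?T \<union> ?S" by (cases "p = 0") (auto simp: is_gen_def)
  next
    fix x assume "x \<in> ?T \<union> ?S"
    then consider c where "x = gen n 0 c" "c ^ e = 1" | p where "x = gen n p 1" "1 \<le> p" "Suc p < n"
      by blast
    then show "x \<in> ?X"
    proof cases
      case 1
      then have "is_gen 0 c" using n by (simp add: is_gen_def)
      then show ?thesis using 1(1) by blast
    next
      case 2
      then have "is_gen p 1" by (simp add: is_gen_def)
      then show ?thesis using 2(1) by blast
    qed
  qed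
  ultimately show ?thesis unfolding Xgens_def by simp
qed

section \<open>Row data of monomial matrices\<close>

lemma G_carrier: "A \<in> G \<Longrightarrow> A \<in> carrier_mat n n"
  by (simp add: Geen_def)

lemma rcol_eqI:
  assumes "A \<in> carrier_mat n n" "i < n" "s < n" "z \<noteq> 0"
    and "\<And>j. j < n \<Longrightarrow> A $$ (i, j) = (if j = s then z else 0)"
  shows "rcol A i = s" "rval A i = z"
proof -
  show r: "rcol A i = s" unfolding rcol_def
    by (rule the_equality) (use assms in \<open>auto split: if_splits\<close>)
  show "rval A i = z" unfolding rval_def r using assms by simp
qed

lemma G_entries:
  assumes A: "A \<in> G" and i: "i < n"
  shows "rcol A i < n" "rval A i \<noteq> 0" "rval A i ^ e = 1"
    "\<And>j. j < n \<Longrightarrow> A $$ (i, j) = (if j = rcol A i then rval A i else 0)"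
proof -
  have dim: "dim_col A = n" using G_carrier[OF A] by simp
  have ex: "\<exists>!j. j < n \<and> A $$ (i, j) \<noteq> 0" using A i by (simp add: Geen_def)
  have r: "rcol A i < n \<and> A $$ (i, rcol A i) \<noteq> 0"
    unfolding rcol_def dim by (rule theI'[OF ex])
  then show "rcol A i < n" "rval A i \<noteq> 0" by (auto simp: rval_def)
  then show "rval A i ^ e = 1" using A i by (auto simp: Geen_def rval_def)
  fix j assume "j < n"
  then show "A $$ (i, j) = (if j = rcol A i then rval A i else 0)"
    using ex r by (auto simp: rval_def)
qed

lemma rcol_inj: assumes A: "A \<in> G" shows "inj_on (rcol A) {..<n}"
proof (rule inj_onI)
  fix i i' assume i: "i \<in> {..<n}" "i' \<in> {..<n}" "rcol A i = rcol A i'"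
  have "\<exists>!l. l < n \<and> A $$ (l, rcol A i) \<noteq> 0"
    using A G_entries(1)[OF A, of i] i by (simp add: Geen_def)
  moreover have "A $$ (i, rcol A i) \<noteq> 0" "A $$ (i', rcol A i) \<noteq> 0"
    using i G_entries(2)[OF A, of i] G_entries(2)[OF A, of i'] by (auto simp: rval_def)
  ultimately show "i = i'" using i by blast
qed

text \<open>Turns the product over nonzero positions in the definition of \<open>Geen\<close> into a
  product over rows.\<close>

lemma nonzero_positions:
  assumes "A \<in> carrier_mat n n" "\<And>i. i < n \<Longrightarrow> s i < n" "\<And>i. i < n \<Longrightarrow> z i \<noteq> 0"
    and "\<And>i j. i < n \<Longrightarrow> j < n \<Longrightarrow> A $$ (i, j) = (if j = s i then z i else 0)"
  shows "(\<Prod>p\<in>{(i, j). i < n \<and> j < n \<and> A $$ (i, j) \<noteq> 0}. A $$ p) = (\<Prod>i<n. z i)"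
proof -
  have "{(i, j). i < n \<and> j < n \<and> A $$ (i, j) \<noteq> 0} = (\<lambda>i. (i, s i)) ` {..<n}"
    using assms by (auto split: if_splits)
  moreover have "inj_on (\<lambda>i. (i, s i)) {..<n}" by (auto intro: inj_onI)
  ultimately show ?thesis using assms by (simp add: prod.reindex)
qed

lemma prod_rval: assumes A: "A \<in> G" shows "(\<Prod>i<n. rval A i) = 1"
proof -
  have "(\<Prod>p\<in>{(i, j). i < n \<and> j < n \<and> A $$ (i, j) \<noteq> 0}. A $$ p) = (\<Prod>i<n. rval A i)"
    using nonzero_positions[of A "rcol A" "rval A"] G_entries[OF A] G_carrier[OF A] by auto
  then show ?thesis using A by (simp add: Geen_def)
qed

text \<open>Membership is recognised from row data alone: an injective self-map of a finite set is
  onto, which yields the condition on columns.\<close>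

lemma GI:
  assumes A: "A \<in> carrier_mat n n" and s: "\<And>i. i < n \<Longrightarrow> s i < n" "inj_on s {..<n}"
    and z: "\<And>i. i < n \<Longrightarrow> z i ^ e = 1" "(\<Prod>i<n. z i) = 1"
    and entry: "\<And>i j. i < n \<Longrightarrow> j < n \<Longrightarrow> A $$ (i, j) = (if j = s i then z i else 0)"
  shows "A \<in> G" "\<And>i. i < n \<Longrightarrow> rcol A i = s i" "\<And>i. i < n \<Longrightarrow> rval A i = z i"
proof -
  have z0: "z i \<noteq> 0" if "i < n" for i using z(1)[OF that] e by (auto simp: power_0_left)
  have row: "\<exists>!j. j < n \<and> A $$ (i, j) \<noteq> 0" if "i < n" for i
    using that s(1) z0 entry by (intro ex1I[of _ "s i"]) (auto split: if_splits)
  have surj: "s ` {..<n} = {..<n}" using s by (intro endo_inj_surj) auto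
  have column: "\<exists>!i. i < n \<and> A $$ (i, j) \<noteq> 0" if j: "j < n" for j
  proof -
    obtain i where i: "i < n" "s i = j" using surj j by (metis imageE lessThan_iff)
    show ?thesis
    proof (rule ex1I[of _ i])
      show "i < n \<and> A $$ (i, j) \<noteq> 0" using i j entry z0 by auto
      fix l assume l: "l < n \<and> A $$ (l, j) \<noteq> 0"
      then have "s l = j" using entry[of l j] j by (metis (full_types))
      then show "l = i" using i l inj_onD[OF s(2), of l i] by simp
    qed
  qed
  have pow: "A $$ (i, j) ^ e = 1" if "i < n" "j < n" "A $$ (i, j) \<noteq> 0" for i j
    using that entry z(1) by (auto split: if_splits)
  have prod: "(\<Prod>p\<in>{(i, j). i < n \<and> j < n \<and> A $$ (i, j) \<noteq> 0}. A $$ p) = 1"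
    using nonzero_positions[of A s z, OF A s(1) z0 entry] z(2) by simp
  show "A \<in> G"
    unfolding Geen_def by (intro CollectI conjI allI impI) (fact A row column pow prod)+
  show "rcol A i = s i" "rval A i = z i" if i: "i < n" for i
    using rcol_eqI[OF A i s(1)[OF i] z0[OF i] entry[OF i]] by auto
qed

lemma G_eqI:
  assumes "A \<in> G" "B \<in> G" "\<And>i. i < n \<Longrightarrow> rcol A i = rcol B i" "\<And>i. i < n \<Longrightarrow> rval A i = rval B i"
  shows "A = B"
proof (rule eq_matI)
  have dim: "dim_row A = n" "dim_col A = n" "dim_row B = n" "dim_col B = n"
    using G_carrier[OF assms(1)] G_carrier[OF assms(2)] by auto
  then show "dim_row A = dim_row B" "dim_col A = dim_col B" by simp_all
  fix i j assume "i < dim_row B" "j < dim_col B"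
  then show "A $$ (i, j) = B $$ (i, j)"
    using G_entries(4)[OF assms(1), of i j] G_entries(4)[OF assms(2), of i j] assms(3,4)[of i] dim
    by simp
qed

lemma one_G: "1\<^sub>m n \<in> G"
  and rcol_one: "i < n \<Longrightarrow> rcol (1\<^sub>m n) i = i"
  and rval_one: "i < n \<Longrightarrow> rval (1\<^sub>m n) i = 1"
proof -
  have "1\<^sub>m n $$ (i, j) = (if j = i then 1 :: complex else 0)" if "i < n" "j < n" for i j
    using that by (simp add: eq_commute)
  note GI[OF one_carrier_mat _ _ _ _ this]
  then show "1\<^sub>m n \<in> G" "i < n \<Longrightarrow> rcol (1\<^sub>m n) i = i" "i < n \<Longrightarrow> rval (1\<^sub>m n) i = 1"
    by simp_all
qed

section \<open>Generators and the length formula\<close>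

lemma gen_mult:
  assumes A: "A \<in> G" and pc: "is_gen p c"
  shows "gen n p c * A \<in> G"
    and "\<And>i. i < n \<Longrightarrow> rcol (gen n p c * A) i = rcol A (sw p i)"
    and "\<And>i. i < n \<Longrightarrow> rval (gen n p c * A) i =
          gcoef p c i * rval A (sw p i)"
proof -
  let ?z = "\<lambda>i. gcoef p c i * rval A (sw p i)"
  let ?s = "\<lambda>i. rcol A (sw p i)"
  have p: "Suc p < n" using pc by (simp add: is_gen_def)
  note c = is_gen_neq_0[OF pc] is_gen_power[OF pc]
  have car: "gen n p c * A \<in> carrier_mat n n" using G_carrier[OF A] by (intro mult_carrier_mat) auto
  have s: "?s i < n" if "i < n" for i using G_entries(1)[OF A] sw_less[OF p that] by blast
  have inj: "inj_on ?s {..<n}"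
    using rcol_inj[OF A] sw_less[OF p] by (intro inj_onI) (metis inj_onD lessThan_iff sw_sw)
  have z: "?z i ^ e = 1" if "i < n" for i
    using G_entries(3)[OF A sw_less[OF p that]] c
    by (simp add: gcoef_def power_mult_distrib power_inverse)
  have pr: "(\<Prod>i<n. ?z i) = 1"
  proof -
    have "(\<Prod>i<n. ?z i) = (\<Prod>i<n. gcoef p c i) *
        (\<Prod>i<n. rval A (sw p i))" by (rule prod.distrib)
    also have "(\<Prod>i<n. rval A (sw p i)) = (\<Prod>i<n. rval A i)"
      by (rule prod.reindex_bij_witness[of _ "sw p" "sw p"]) (auto simp: sw_less[OF p])
    also have "\<dots> = 1" by (rule prod_rval[OF A])
    also have "(\<Prod>i<n. gcoef p c i) =
        (\<Prod>i<n. if i = p then inverse c else 1) * (\<Prod>i<n. if i = Suc p then c else 1)"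
      by (subst prod.distrib[symmetric], rule prod.cong) (auto simp: gcoef_def)
    also have "\<dots> = 1" using p c by (simp add: prod.delta)
    finally show ?thesis by simp
  qed
  have entry: "(gen n p c * A) $$ (i, j) = (if j = ?s i then ?z i else 0)" if "i < n" "j < n" for i j
    using gen_mult_index[OF G_carrier[OF A] p that] G_entries(4)[OF A sw_less[OF p that(1)] that(2)]
    by auto
  show "gen n p c * A \<in> G" "\<And>i. i < n \<Longrightarrow> rcol (gen n p c * A) i = ?s i"
    "\<And>i. i < n \<Longrightarrow> rval (gen n p c * A) i = ?z i"
    using GI[OF car s inj z pr entry] by blast+
qed

text \<open>Only the pair of rows \<open>p, p + 1\<close> changes its cost: rows other than the first are not rescaled,
  and the value in the first row never enters.\<close>

lemma ell_gen_mult: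
  assumes A: "A \<in> G" and pc: "is_gen p c"
  shows "ell n A + cost (gen n p c * A) p (Suc p) = ell n (gen n p c * A) + cost A p (Suc p)"
proof -
  let ?B = "gen n p c * A"
  let ?R = "pairs n - {(p, Suc p)}"
  have p: "Suc p < n" using pc by (simp add: is_gen_def)
  then have mem: "(p, Suc p) \<in> pairs n" by (simp add: pairs_def)
  have split: "ell n C = cost C p (Suc p) + (\<Sum>(j, i)\<in>?R. cost C j i)" for C
    unfolding ell_def using sum.remove[OF finite_pairs mem, of "\<lambda>(j, i). cost C j i"] by simp
  have cost: "cost ?B j i = cost A (sw p j) (sw p i)" if ji: "(j, i) \<in> ?R" for j i
  proof -
    \<comment> \<open>Only \<open>p = 0\<close> allows \<open>c\<close> to differ from
      \<open>1\<close>. Then rows \<open>0\<close> and \<open>1\<close> are rescaled, but neither is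
      the lower row of a pair other than \<open>(0, 1)\<close>.\<close>
    have "p = 0 \<Longrightarrow> i \<noteq> p \<and> i \<noteq> Suc p" using ji by (auto simp: pairs_def)
    then have "gcoef p c i = 1"
      using pc by (auto simp: is_gen_def gcoef_def split: if_splits)
    then show ?thesis using gen_mult[OF A pc] ji by (auto simp: cost_def pairs_def)
  qed
  have "(\<Sum>(j, i)\<in>?R. cost ?B j i) = (\<Sum>(j, i)\<in>?R. cost A j i)"
    by (rule sum.reindex_bij_witness[of _ "map_prod (sw p) (sw p)" "map_prod (sw p) (sw p)"])
       (use p cost in \<open>auto simp: pairs_def sw_def split: if_splits\<close>)
  then show ?thesis using split[of A] split[of ?B] by simp
qed

text \<open>Only the pair of rows \<open>p\<close> and \<open>p + 1\<close> matters. If it is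
  inverted, it costs 1; after the multiplication it is not inverted and carries
  \<open>c * rval A p\<close> in its lower row, so it costs 0 or 2 according as this value is 1 or
  not. If it is not inverted, it costs 0 or 2 and becomes inverted, with cost 1.\<close>

lemma ell_desc:
  assumes A: "A \<in> G" and pc: "is_gen p c"
  shows "desc p c A \<Longrightarrow> ell n A = ell n (gen n p c * A) + 1"
    and "\<not> desc p c A \<Longrightarrow> ell n (gen n p c * A) = ell n A + 1"
proof -
  have p: "p < n" "Suc p < n" using pc by (auto simp: is_gen_def)
  have "rcol A p \<noteq> rcol A (Suc p)" using inj_onD[OF rcol_inj[OF A], of p "Suc p"] p by auto
  \<comment> \<open>The subtraction is one of natural numbers; the second claim ensures that it is
    not truncated.\<close>
  then have "cost A p (Suc p) = (if desc p c A then cost (gen n p c * A) p (Suc p) + 1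
      else cost (gen n p c * A) p (Suc p) - 1)"
    "\<not> desc p c A \<Longrightarrow> cost (gen n p c * A) p (Suc p) \<noteq> 0"
    using gen_mult(2,3)[OF A pc p(1)] gen_mult(2,3)[OF A pc p(2)]
    by (auto simp: cost_def desc_def sw_def gcoef_def)
  then show "desc p c A \<Longrightarrow> ell n A = ell n (gen n p c * A) + 1"
    and "\<not> desc p c A \<Longrightarrow> ell n (gen n p c * A) = ell n A + 1"
    using ell_gen_mult[OF A pc] by simp_all
qed

text \<open>Suppose there is no descent. In rows \<open>0\<close> and \<open>1\<close> the choice
  \<open>c = inverse (rval A 0)\<close> would make an inversion a descent, so the columns increase
  and row \<open>1\<close> has value 1. This value excludes an inversion with row \<open>2\<close>,
  and so on down the rows. Hence the permutation is trivial and all values below the first row are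
  1; the product condition takes care of the first row.\<close>

lemma ex_desc:
  assumes A: "A \<in> G" and ne: "A \<noteq> 1\<^sub>m n"
  shows "\<exists>p c. is_gen p c \<and> desc p c A"
proof (rule ccontr)
  assume "\<not> ?thesis"
  then have nd: "\<And>p c. is_gen p c \<Longrightarrow> \<not> desc p c A" by blast
  have neq: "rcol A i \<noteq> rcol A (Suc i)" if "Suc i < n" for i
    using inj_onD[OF rcol_inj[OF A], of i "Suc i"] that by auto
  have step: "Suc i < n \<longrightarrow> rcol A i < rcol A (Suc i) \<and> rval A (Suc i) = 1" for i
  proof (induction i)
    case 0
    show ?case
    proof
      assume n': "Suc 0 < n"
      have "is_gen 0 (inverse (rval A 0))"
        using G_entries(3)[OF A, of 0] n' by (simp add: is_gen_def power_inverse)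
      from nd[OF this] show "rcol A 0 < rcol A (Suc 0) \<and> rval A (Suc 0) = 1"
        using neq[OF n'] G_entries(2)[OF A, of 0] n' by (auto simp: desc_def)
    qed
  next
    case (Suc i)
    show ?case
    proof
      assume n': "Suc (Suc i) < n"
      then have "is_gen (Suc i) 1" by (simp add: is_gen_def)
      from nd[OF this] show "rcol A (Suc i) < rcol A (Suc (Suc i)) \<and> rval A (Suc (Suc i)) = 1"
        using neq[OF n'] Suc n' by (auto simp: desc_def)
    qed
  qed
  have col: "rcol A i = i" if "i < n" for i
    using strictly_increasing_eq_id[of n "rcol A" i] G_entries(1)[OF A] step that by blast
  have val: "rval A i = 1" if "0 < i" "i < n" for i
    using step[of "i - 1"] that by simp
  have "(\<Prod>i<n. rval A i) = rval A 0 * (\<Prod>i\<in>{..<n} - {0}. rval A i)"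
    using n by (intro prod.remove) auto
  also have "(\<Prod>i\<in>{..<n} - {0}. rval A i) = 1" using val by (intro prod.neutral) auto
  finally have "rval A 0 = 1" using prod_rval[OF A] by simp
  then have "rval A i = 1" if "i < n" for i using val that by (cases "i = 0") auto
  then have "A = 1\<^sub>m n" using A one_G col rcol_one rval_one by (intro G_eqI) auto
  then show False using ne by simp
qed

lemma ell_one: "ell n (1\<^sub>m n) = 0"
  unfolding ell_def by (rule sum.neutral) (auto simp: cost_def pairs_def rcol_one rval_one)

section \<open>Words and the length function\<close>

lemma word_prod_simps [simp]: "word_prod n [] = 1\<^sub>m n" "word_prod n (x # xs) = x * word_prod n xs"
  by (simp_all add: word_prod_def)

lemma XgensE: assumes "x \<in> Xgens e n" obtains p c where "x = gen n p c" "is_gen p c"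
  using assms unfolding Xgens_eq by blast

lemma Xgens_carrier: "x \<in> Xgens e n \<Longrightarrow> x \<in> carrier_mat n n"
  by (erule XgensE) simp

lemma word_prod_G:
  "set xs \<subseteq> Xgens e n \<Longrightarrow> word_prod n xs \<in> G \<and> ell n (word_prod n xs) \<le> length xs"
proof (induction xs)
  case Nil
  then show ?case using one_G ell_one by simp
next
  case (Cons x xs)
  then obtain p c where x: "x = gen n p c" "is_gen p c" by (auto elim: XgensE)
  then show ?case using Cons gen_mult(1)[OF _ x(2)] ell_desc[OF _ x(2)]
    by (cases "desc p c (word_prod n xs)") (auto split: if_splits)
qed

lemma ex_word: "A \<in> G \<Longrightarrow> \<exists>xs. set xs \<subseteq> Xgens e n \<and> length xs = ell n A \<and> word_prod n xs = A"
proof (induction "ell n A" arbitrary: A rule: less_induct)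
  case less
  show ?case
  proof (cases "A = 1\<^sub>m n")
    case True
    then show ?thesis using ell_one by (intro exI[of _ "[]"]) auto
  next
    case False
    obtain p c where pc: "is_gen p c" "desc p c A" using ex_desc[OF less.prems False] by blast
    let ?B = "gen n p c * A"
    have B: "?B \<in> G" "ell n A = ell n ?B + 1"
      using gen_mult(1)[OF less.prems pc(1)] ell_desc(1)[OF less.prems pc(1)] pc(2) by auto
    then obtain xs where xs: "set xs \<subseteq> Xgens e n" "length xs = ell n ?B" "word_prod n xs = ?B"
      using less.hyps[of ?B] by auto
    have "gen n p c * ?B = gen n p c * gen n p c * A"
      using G_carrier[OF less.prems] by (intro assoc_n[symmetric]) auto
    also have "\<dots> = A"
      using gen_gen[of p n c] is_gen_neq_0[OF pc(1)] pc(1) G_carrier[OF less.prems]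
      by (simp add: is_gen_def)
    finally show ?thesis
      using xs B pc by (intro exI[of _ "gen n p c # xs"]) (auto simp: Xgens_eq)
  qed
qed

text \<open>Stripping descents produces a word of length \<open>ell n A\<close>; no shorter one
  exists, as prepending a letter raises \<open>ell\<close> by at most one.\<close>

lemma len_eq_ell: assumes "A \<in> G" shows "len e n A = ell n A"
  unfolding len_def
proof (rule Least_equality)
  show "\<exists>xs. set xs \<subseteq> Xgens e n \<and> length xs = ell n A \<and> word_prod n xs = A"
    by (rule ex_word[OF assms])
  show "\<And>m. \<exists>xs. set xs \<subseteq> Xgens e n \<and> length xs = m \<and> word_prod n xs = A \<Longrightarrow> ell n A \<le> m"
    using word_prod_G by blast
qed

lemma word_prod_append:
  assumes "set xs \<subseteq> Xgens e n" "set ys \<subseteq> Xgens e n"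
  shows "word_prod n (xs @ ys) = word_prod n xs * word_prod n ys"
  using assms
proof (induction xs)
  case Nil
  then show ?case using word_prod_G[of ys] G_carrier[of "word_prod n ys"] by simp
next
  case (Cons x xs)
  have "x * word_prod n xs * word_prod n ys = x * (word_prod n xs * word_prod n ys)"
    using Cons.prems word_prod_G[of ys] word_prod_G[of xs] G_carrier Xgens_carrier
    by (intro assoc_n) auto
  then show ?case using Cons by simp
qed

text \<open>Every generator is an involution, so reversing a word inverts it.\<close>

lemma word_prod_rev:
  assumes "set xs \<subseteq> Xgens e n"
  shows "word_prod n (rev xs) * word_prod n xs = 1\<^sub>m n"
  using assms
proof (induction xs)
  case (Cons x xs)
  obtain p c where x: "x = gen n p c" "is_gen p c" using Cons.prems by (auto elim: XgensE)
  have xx: "x * x = 1\<^sub>m n"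
    using gen_gen[of p n c] is_gen_neq_0[OF x(2)] x by (auto simp: is_gen_def)
  let ?u = "word_prod n (rev xs)" and ?w = "word_prod n xs"
  have car: "x \<in> carrier_mat n n" "?u \<in> carrier_mat n n" "?w \<in> carrier_mat n n"
    using Cons.prems word_prod_G[of xs] word_prod_G[of "rev xs"] G_carrier Xgens_carrier by auto
  have "word_prod n (rev (x # xs)) * word_prod n (x # xs) = (?u * x) * (x * ?w)"
    using word_prod_append[of "rev xs" "[x]"] Cons.prems car by auto
  also have "\<dots> = ?u * (x * (x * ?w))" using car by (intro assoc_n) auto
  also have "x * (x * ?w) = x * x * ?w" using car by (intro assoc_n[symmetric]) auto
  also have "\<dots> = ?w" using xx car by simp
  also have "?u * ?w = 1\<^sub>m n" using Cons by simp
  finally show ?case .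
qed simp

section \<open>The group structure, inverses and transposition\<close>

definition GG where "GG = \<lparr>carrier = G, mult = (*), one = 1\<^sub>m n\<rparr>"

lemma GG_simps [simp]: "carrier GG = G" "mult GG = (*)" "one GG = 1\<^sub>m n"
  by (simp_all add: GG_def)

lemma mult_G: assumes "A \<in> G" "B \<in> G" shows "A * B \<in> G" "ell n (A * B) \<le> ell n A + ell n B"
proof -
  obtain xs where xs: "set xs \<subseteq> Xgens e n" "length xs = ell n A" "word_prod n xs = A"
    using ex_word assms by blast
  obtain ys where ys: "set ys \<subseteq> Xgens e n" "length ys = ell n B" "word_prod n ys = B"
    using ex_word assms by blast
  show "A * B \<in> G" "ell n (A * B) \<le> ell n A + ell n B"
    using word_prod_G[of "xs @ ys"] word_prod_append[OF xs(1) ys(1)] xs ys by auto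
qed

lemma group_GG: "group GG"
proof (rule groupI)
  show "\<exists>B\<in>carrier GG. B \<otimes>\<^bsub>GG\<^esub> A = \<one>\<^bsub>GG\<^esub>" if A: "A \<in> carrier GG" for A
  proof -
    obtain xs where xs: "set xs \<subseteq> Xgens e n" "word_prod n xs = A" using ex_word[of A] A by auto
    then show ?thesis using word_prod_rev[OF xs(1)] word_prod_G[of "rev xs"] by auto
  qed
qed (auto simp: mult_G one_G dest!: G_carrier intro: assoc_n)

sublocale GG: group GG by (rule group_GG)

lemma inv_word: assumes "set xs \<subseteq> Xgens e n" shows "inv\<^bsub>GG\<^esub> (word_prod n xs) = word_prod n (rev xs)"
  using GG.inv_equality[of "word_prod n (rev xs)" "word_prod n xs"] word_prod_rev[OF assms]
    word_prod_G[OF assms] word_prod_G[of "rev xs"] assms by simp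

lemma ell_inv: assumes "A \<in> G" shows "ell n (inv\<^bsub>GG\<^esub> A) = ell n A"
proof -
  have "ell n (inv\<^bsub>GG\<^esub> A) \<le> ell n A" if A: "A \<in> G" for A
  proof -
    obtain xs where xs: "set xs \<subseteq> Xgens e n" "length xs = ell n A" "word_prod n xs = A"
      using ex_word A by blast
    then show ?thesis using inv_word[OF xs(1)] word_prod_G[of "rev xs"] by simp
  qed
  from this[of A] this[of "inv\<^bsub>GG\<^esub> A"] show ?thesis
    using assms GG.inv_closed[of A] GG.inv_inv[of A] by simp
qed

lemma minv_eq: assumes A: "A \<in> G" shows "minv n A = inv\<^bsub>GG\<^esub> A"
  unfolding minv_def
proof (rule some_equality)
  have I: "inv\<^bsub>GG\<^esub> A \<in> G" using GG.inv_closed[of A] A by simp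
  show "inv\<^bsub>GG\<^esub> A \<in> carrier_mat n n \<and> A * inv\<^bsub>GG\<^esub> A = 1\<^sub>m n \<and> inv\<^bsub>GG\<^esub> A * A = 1\<^sub>m n"
    using I G_carrier GG.r_inv[of A] GG.l_inv[of A] A by simp
  fix v assume v: "v \<in> carrier_mat n n \<and> A * v = 1\<^sub>m n \<and> v * A = 1\<^sub>m n"
  have "v = (inv\<^bsub>GG\<^esub> A * A) * v" using GG.l_inv[of A] A v left_mult_one_mat[of v n n] by simp
  also have "\<dots> = inv\<^bsub>GG\<^esub> A * (A * v)"
    using G_carrier[OF I] G_carrier[OF A] v by (intro assoc_n) auto
  also have "\<dots> = inv\<^bsub>GG\<^esub> A" using v right_mult_one_mat[OF G_carrier[OF I]] by simp
  finally show "v = inv\<^bsub>GG\<^esub> A" .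
qed

text \<open>Transposition reverses products and sends the generator with parameter \<open>c\<close>
  to the one with \<open>inverse c\<close>. It thus preserves lengths and will serve as
  \<open>mir\<close>.\<close>

lemma transpose_word:
  assumes "set xs \<subseteq> Xgens e n"
  shows "\<exists>ys. set ys \<subseteq> Xgens e n \<and> length ys = length xs \<and>
           transpose_mat (word_prod n xs) = word_prod n ys"
  using assms
proof (induction xs)
  case Nil
  then show ?case by (intro exI[of _ "[]"]) auto
next
  case (Cons x xs)
  then obtain ys where ys: "set ys \<subseteq> Xgens e n" "length ys = length xs"
      "transpose_mat (word_prod n xs) = word_prod n ys" by auto
  obtain p c where x: "x = gen n p c" "is_gen p c" using Cons.prems by (auto elim: XgensE)
  have "is_gen p (inverse c)" using x(2) by (auto simp: is_gen_def power_inverse split: if_splits)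
  then have t: "transpose_mat x \<in> Xgens e n"
    using gen_transpose[OF is_gen_neq_0[OF x(2)]] x by (auto simp: Xgens_eq)
  have "transpose_mat (x * word_prod n xs) = word_prod n ys * transpose_mat x"
    using transpose_mult[of x n n "word_prod n xs" n] ys(3) Xgens_carrier word_prod_G[of xs]
      G_carrier Cons.prems by auto
  also have "\<dots> = word_prod n (ys @ [transpose_mat x])"
    using word_prod_append[OF ys(1), of "[transpose_mat x]"] t Xgens_carrier[OF t] by simp
  finally show ?case using ys t by (intro exI[of _ "ys @ [transpose_mat x]"]) auto
qed

lemma transpose_G:
  assumes "A \<in> G"
  shows "transpose_mat A \<in> G" "ell n (transpose_mat A) = ell n A"
proof -
  have *: "transpose_mat A \<in> G \<and> ell n (transpose_mat A) \<le> ell n A" if A: "A \<in> G" for A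
  proof -
    obtain xs where xs: "set xs \<subseteq> Xgens e n" "length xs = ell n A" "word_prod n xs = A"
      using ex_word A by blast
    obtain ys where "set ys \<subseteq> Xgens e n" "length ys = length xs" "transpose_mat A = word_prod n ys"
      using transpose_word[OF xs(1)] xs(3) by blast
    then show ?thesis using word_prod_G[of ys] xs by simp
  qed
  from *[of A] *[of "transpose_mat A"] show "transpose_mat A \<in> G" "ell n (transpose_mat A) = ell n A"
    using assms by auto
qed

end

subsection \<open>The interval below a power of \<open>\<lambda>\<close>\<close>

locale geen_interval = geen +
  fixes k :: nat
  assumes k: "1 \<le> k" "k \<le> e - 1"
begin

section \<open>The diagonal matrix at the top of the interval\<close>

definition g where "g = lam e n ^\<^sub>m k"

definition kap where "kap = zeta e ^ k"

text \<open>The diagonal of \<open>g\<close>; the first entry makes the product of all entries equal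
  to 1.\<close>

definition gd :: "nat \<Rightarrow> complex" where
  "gd i = (if i = 0 then inverse (zeta e ^ (n - 1)) ^ k else kap)"

lemma kap_neq_1: "kap \<noteq> 1"
  unfolding kap_def using zeta_power_neq_1 k e by simp

lemma zeta_neq_0: "zeta e \<noteq> 0"
  by (simp add: zeta_def)

lemma gd_power: "gd i ^ e = 1"
proof -
  have "(zeta e ^ m) ^ e = 1" for m
    using zeta_power_e[of e] e by (simp add: power_mult[symmetric] mult.commute[of m] power_mult)
  moreover have "(z ^ k) ^ e = 1" if "z ^ e = 1" for z :: complex
    using that by (simp add: power_mult[symmetric] mult.commute[of k] power_mult)
  ultimately show ?thesis by (simp add: gd_def kap_def power_inverse)
qed

lemma kap_neq_0: "kap \<noteq> 0"
  unfolding kap_def using zeta_neq_0 by simp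

lemma lam_carrier: "lam e n \<in> carrier_mat n n"
  by (simp add: lam_def)

lemma g_carrier: "g \<in> carrier_mat n n"
  unfolding g_def by (rule pow_carrier_mat[OF lam_carrier])

lemma lam_power_index:
  assumes "i < n" "j < n"
  shows "(lam e n ^\<^sub>m m) $$ (i, j) =
    (if j = i then (if i = 0 then inverse (zeta e ^ (n - 1)) else zeta e) ^ m else 0)"
  using assms
proof (induction m arbitrary: j)
  case 0
  then show ?case using lam_carrier by simp
next
  case (Suc m)
  define d where "d i = (if i = 0 then inverse (zeta e ^ (n - 1)) else zeta e)" for i :: nat
  have "int n - 1 = int (n - 1)" using n by simp
  then have "zeta e powi - (int n - 1) = inverse (zeta e ^ (n - 1))"
    by (simp only: power_int_minus power_int_of_nat)
  then have lam: "lam e n $$ (l, j) = (if l = j then d l else 0)" if "l < n" for l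
    using that Suc.prems unfolding lam_def d_def by simp
  have "(lam e n ^\<^sub>m Suc m) $$ (i, j) = (\<Sum>l<n. (lam e n ^\<^sub>m m) $$ (i, l) * lam e n $$ (l, j))"
    using index_mult_mat_sum[OF pow_carrier_mat[OF lam_carrier] lam_carrier Suc.prems] by simp
  also have "\<dots> = (\<Sum>l<n. if l = i then d i ^ m * (if i = j then d i else 0) else 0)"
    using Suc lam by (intro sum.cong) (auto simp: d_def)
  also have "\<dots> = (if j = i then d i ^ Suc m else 0)"
    using Suc.prems by (auto simp: sum.delta)
  finally show ?case by (simp add: d_def)
qed

lemma g_index: "i < n \<Longrightarrow> j < n \<Longrightarrow> g $$ (i, j) = (if j = i then gd i else 0)"
  unfolding g_def gd_def kap_def using lam_power_index[of i j k] by simp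

lemma g_G: "g \<in> G" and rcol_g: "i < n \<Longrightarrow> rcol g i = i" and rval_g: "i < n \<Longrightarrow> rval g i = gd i"
proof -
  have "(\<Prod>i<n. gd i) = gd 0 * (\<Prod>i\<in>{..<n} - {0}. gd i)"
    using n by (intro prod.remove) auto
  also have "(\<Prod>i\<in>{..<n} - {0}. gd i) = kap ^ (n - 1)"
    using n by (simp add: gd_def)
  also have "gd 0 * kap ^ (n - 1) = 1"
    using zeta_neq_0
    by (simp add: gd_def kap_def power_inverse power_mult[symmetric] mult.commute)
  finally have pr: "(\<Prod>i<n. gd i) = 1" .
  have inj: "inj_on (\<lambda>i. i) {..<n}" by simp
  note * = GI[of g "\<lambda>i. i" gd, OF g_carrier _ inj gd_power pr g_index]
  show "g \<in> G" "i < n \<Longrightarrow> rcol g i = i" "i < n \<Longrightarrow> rval g i = gd i"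
    using * by blast+
qed

lemma g_mult:
  assumes v: "v \<in> G" and i: "i < n"
  shows "rcol (g * v) i = rcol v i" "rval (g * v) i = gd i * rval v i"
proof -
  have gd0: "gd i \<noteq> 0" using gd_power[of i] e by (auto simp: power_0_left)
  have entry: "(g * v) $$ (i, j) = (if j = rcol v i then gd i * rval v i else 0)" if j: "j < n" for j
  proof -
    have "(g * v) $$ (i, j) = (\<Sum>l<n. g $$ (i, l) * v $$ (l, j))"
      by (rule index_mult_mat_sum[OF g_carrier G_carrier[OF v] i j])
    also have "\<dots> = (\<Sum>l<n. if l = i then gd i * v $$ (i, j) else 0)"
      using i by (intro sum.cong) (auto simp: g_index)
    also have "\<dots> = gd i * v $$ (i, j)" using i by (simp add: sum.delta)
    finally show ?thesis using G_entries(4)[OF v i j] by simp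
  qed
  have "g * v \<in> carrier_mat n n" using g_carrier G_carrier[OF v] by (rule mult_carrier_mat)
  then show "rcol (g * v) i = rcol v i" "rval (g * v) i = gd i * rval v i"
    using rcol_eqI[of "g * v" i "rcol v i" "gd i * rval v i"] i gd0 entry G_entries(1,2)[OF v i]
    by auto
qed

lemma mult_g:
  assumes v: "v \<in> G" and i: "i < n"
  shows "rcol (v * g) i = rcol v i" "rval (v * g) i = rval v i * gd (rcol v i)"
proof -
  have gd0: "gd (rcol v i) \<noteq> 0" using gd_power[of "rcol v i"] e by (auto simp: power_0_left)
  have r: "rcol v i < n" by (rule G_entries(1)[OF v i])
  have entry: "(v * g) $$ (i, j) = (if j = rcol v i then rval v i * gd (rcol v i) else 0)"
    if j: "j < n" for j
  proof -
    have "(v * g) $$ (i, j) = (\<Sum>l<n. v $$ (i, l) * g $$ (l, j))"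
      by (rule index_mult_mat_sum[OF G_carrier[OF v] g_carrier i j])
    also have "\<dots> = (\<Sum>l<n. if l = rcol v i then rval v i * g $$ (l, j) else 0)"
      using G_entries(4)[OF v i] by (intro sum.cong) auto
    also have "\<dots> = rval v i * g $$ (rcol v i, j)" using r by (simp add: sum.delta)
    finally show ?thesis using g_index[OF r j] by simp
  qed
  have "v * g \<in> carrier_mat n n" using G_carrier[OF v] g_carrier by (rule mult_carrier_mat)
  then show "rcol (v * g) i = rcol v i" "rval (v * g) i = rval v i * gd (rcol v i)"
    using rcol_eqI[of "v * g" i "rcol v i" "rval v i * gd (rcol v i)"] i gd0 entry r
      G_entries(2)[OF v i] by auto
qed

text \<open>Membership in the interval below \<open>g\<close>, expressed by row data; see
  \<open>D_iff\<close>.\<close>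

definition simple :: "complex mat \<Rightarrow> bool" where
  "simple w \<longleftrightarrow> (\<forall>(j, i)\<in>pairs n. rcol w j < rcol w i \<longrightarrow> rval w i = 1 \<or> rval w i = kap)"

lemma ell_g: "ell n g = (\<Sum>p\<in>pairs n. 2)"
  unfolding ell_def
  by (intro sum.cong) (auto simp: pairs_def cost_def rcol_g rval_g gd_def kap_neq_1)

text \<open>Each pair of rows contributes at least \<open>2\<close> to \<open>ell w + ell v\<close>, and exactly \<open>2\<close> if and only if
  the lower of two rows in increasing position carries the value \<open>1\<close> or \<open>kap\<close> in \<open>w\<close>.\<close>

lemma ell_complement_iff:
  assumes w: "w \<in> G" and col: "\<And>i. i < n \<Longrightarrow> rcol w i = rcol v i"
    and val: "\<And>i j. j < i \<Longrightarrow> i < n \<Longrightarrow> rcol w j < rcol w i \<Longrightarrow> rval w i = kap * rval v i"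
  shows "ell n w + ell n v = ell n g \<longleftrightarrow> simple w"
proof -
  define f where "f = (\<lambda>(j, i). cost w j i + cost v j i)"
  have f: "2 \<le> f (j, i) \<and> (f (j, i) = 2 \<longleftrightarrow> (rcol w j < rcol w i \<longrightarrow> rval w i = 1 \<or> rval w i = kap))"
    if ji: "(j, i) \<in> pairs n" for j i
  proof -
    have ji': "j < i" "i < n" "j < n" using ji by (auto simp: pairs_def)
    have ne: "rcol w j \<noteq> rcol w i" using inj_onD[OF rcol_inj[OF w], of j i] ji' by auto
    show ?thesis
    proof (cases "rcol w j < rcol w i")
      case True
      then have v: "rval v i = 1 \<longleftrightarrow> rval w i = kap"
        using val[OF ji'(1,2) True] kap_neq_0 by auto
      then show ?thesis using True col ji' kap_neq_1 by (auto simp: f_def cost_def)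
    next
      case False
      then show ?thesis using ne col ji' by (auto simp: f_def cost_def)
    qed
  qed
  have sum: "ell n w + ell n v = sum f (pairs n)"
    unfolding ell_def f_def by (simp add: sum.distrib[symmetric] case_prod_beta)
  have "sum f (pairs n) = ell n g \<longleftrightarrow> (\<forall>p\<in>pairs n. f p = 2)"
  proof
    assume eq: "sum f (pairs n) = ell n g"
    show "\<forall>p\<in>pairs n. f p = 2"
    proof
      fix p assume p: "p \<in> pairs n"
      have "2 = f p"
        by (rule sum_mono_inv[of "\<lambda>_. 2" "pairs n" f])
           (use eq ell_g f p finite_pairs in auto)
      then show "f p = 2" by simp
    qed
  qed (simp add: ell_g)
  also have "\<dots> \<longleftrightarrow> simple w" unfolding simple_def using f by (auto simp: case_prod_beta)
  finally show ?thesis using sum by simp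
qed

text \<open>The cofactor has the same length as its inverse \<open>v\<close>, and
  \<open>w = g * v\<close>. Multiplication by \<open>g\<close> from the left scales every row below
  the first by \<open>kap\<close>, so \<open>ell_complement_iff\<close> applies.\<close>

lemma prefix_iff_simple:
  assumes w: "w \<in> G"
  shows "ell n w + ell n (inv\<^bsub>GG\<^esub> w * g) = ell n g \<longleftrightarrow> simple w"
proof -
  define v where "v = inv\<^bsub>GG\<^esub> g * w"
  have v: "v \<in> G" unfolding v_def using GG.inv_closed[of g] g_G w mult_G by simp
  have "inv\<^bsub>GG\<^esub> (inv\<^bsub>GG\<^esub> w * g) = v"
    unfolding v_def using GG.inv_mult_group[of "inv\<^bsub>GG\<^esub> w" g] GG.inv_closed[of w] w g_G by simp
  then have "ell n (inv\<^bsub>GG\<^esub> w * g) = ell n v"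
    using ell_inv[of "inv\<^bsub>GG\<^esub> w * g"] mult_G[of "inv\<^bsub>GG\<^esub> w" g] GG.inv_closed[of w] w g_G by simp
  moreover have gv: "g * v = w"
    using GG.m_assoc[of g "inv\<^bsub>GG\<^esub> g" w] GG.r_inv[of g] GG.l_one[of w] GG.inv_closed[of g] g_G w
    by (simp add: v_def)
  moreover have "ell n w + ell n v = ell n g \<longleftrightarrow> simple w"
    using w
  proof (rule ell_complement_iff)
    show "rcol w i = rcol v i" if "i < n" for i using g_mult(1)[OF v that] gv by simp
    show "rval w i = kap * rval v i" if "j < i" "i < n" for i j
      using g_mult(2)[OF v that(2)] gv that(1) by (simp add: gd_def)
  qed
  ultimately show ?thesis by simp
qed

text \<open>Now \<open>w = v * g\<close>, and the value in row \<open>i\<close> is scaled by the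
  diagonal entry of its column. In a pair that is not inverted, the column of the lower row exceeds
  another column, so it is not the first one and the factor is again \<open>kap\<close>.\<close>

lemma suffix_iff_simple:
  assumes w: "w \<in> G"
  shows "ell n w + ell n (g * inv\<^bsub>GG\<^esub> w) = ell n g \<longleftrightarrow> simple w"
proof -
  define v where "v = w * inv\<^bsub>GG\<^esub> g"
  have v: "v \<in> G" unfolding v_def using GG.inv_closed[of g] g_G w mult_G by simp
  have "inv\<^bsub>GG\<^esub> (g * inv\<^bsub>GG\<^esub> w) = v"
    unfolding v_def using GG.inv_mult_group[of g "inv\<^bsub>GG\<^esub> w"] GG.inv_closed[of w] w g_G by simp
  then have "ell n (g * inv\<^bsub>GG\<^esub> w) = ell n v"
    using ell_inv[of "g * inv\<^bsub>GG\<^esub> w"] mult_G[of g "inv\<^bsub>GG\<^esub> w"] GG.inv_closed[of w] w g_G by simp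
  moreover have gv: "v * g = w"
    using GG.m_assoc[of w "inv\<^bsub>GG\<^esub> g" g] GG.l_inv[of g] GG.r_one[of w] GG.inv_closed[of g] g_G w
    by (simp add: v_def)
  moreover have "ell n w + ell n v = ell n g \<longleftrightarrow> simple w"
    using w
  proof (rule ell_complement_iff)
    show "rcol w i = rcol v i" if "i < n" for i using mult_g(1)[OF v that] gv by simp
    then show "rval w i = kap * rval v i" if "j < i" "i < n" "rcol w j < rcol w i" for i j
      using mult_g(2)[OF v that(2)] gv that by (simp add: gd_def)
  qed
  ultimately show ?thesis by simp
qed

section \<open>Prefixes and joins of two generators\<close>

sublocale LG: length_group GG "len e n" g
  by unfold_locales

lemma pre_iff:
  assumes "u \<in> G" "w \<in> G"
  shows "LG.pre u w \<longleftrightarrow> ell n u + ell n (inv\<^bsub>GG\<^esub> u * w) = ell n w"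
proof -
  have "inv\<^bsub>GG\<^esub> u * w \<in> G" using assms GG.inv_closed[of u] mult_G by simp
  then show ?thesis unfolding LG.pre_def using assms by (simp add: len_eq_ell)
qed

lemma D_iff: "w \<in> LG.D \<longleftrightarrow> w \<in> G \<and> simple w"
  unfolding LG.D_def using pre_iff g_G prefix_iff_simple by auto

lemma gen_G: assumes pc: "is_gen p c"
  shows "gen n p c \<in> G" "ell n (gen n p c) = 1" "inv\<^bsub>GG\<^esub> (gen n p c) = gen n p c"
proof -
  have one: "gen n p c * 1\<^sub>m n = gen n p c" by (rule right_mult_one_mat[OF gen_carrier])
  have p: "Suc p < n" using pc by (simp add: is_gen_def)
  show G: "gen n p c \<in> G" using gen_mult(1)[OF one_G pc] one by simp
  have "\<not> desc p c (1\<^sub>m n)" using p by (simp add: desc_def rcol_one rval_one)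
  then show "ell n (gen n p c) = 1" using ell_desc(2)[OF one_G pc] one ell_one by simp
  show "inv\<^bsub>GG\<^esub> (gen n p c) = gen n p c"
    using GG.inv_equality[of "gen n p c" "gen n p c"] gen_gen[OF p is_gen_neq_0[OF pc]] G by simp
qed

lemma pre_gen_iff:
  assumes pc: "is_gen p c" and w: "w \<in> G"
  shows "LG.pre (gen n p c) w \<longleftrightarrow> desc p c w"
  unfolding pre_iff[OF gen_G(1)[OF pc] w] gen_G(2,3)[OF pc]
  using ell_desc[OF w pc] by (cases "desc p c w") auto

text \<open>Since \<open>ell\<close> is subadditive and \<open>ell n (word_prod n xs)\<close> is at
  most \<open>length xs\<close>, the hypothesis forces the word to be reduced and its length to
  split off from \<open>w\<close>.\<close>

lemma pre_word:
  assumes xs: "set xs \<subseteq> Xgens e n" and w: "w \<in> G"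
    and ell: "ell n (word_prod n (rev xs) * w) + length xs = ell n w"
  shows "LG.pre (word_prod n xs) w"
proof -
  let ?u = "word_prod n xs"
  have u: "?u \<in> G" "ell n ?u \<le> length xs" using word_prod_G[OF xs] by auto
  have inv: "inv\<^bsub>GG\<^esub> ?u = word_prod n (rev xs)" by (rule inv_word[OF xs])
  have iG: "inv\<^bsub>GG\<^esub> ?u \<in> G" using GG.inv_closed[of ?u] u by simp
  have "?u * (inv\<^bsub>GG\<^esub> ?u * w) = w"
    using GG.m_assoc[of ?u "inv\<^bsub>GG\<^esub> ?u" w] GG.r_inv[of ?u] GG.l_one[of w] u w iG by simp
  then have "ell n w \<le> ell n ?u + ell n (inv\<^bsub>GG\<^esub> ?u * w)"
    using mult_G(2)[OF u(1) mult_G(1)[OF iG w]] by simp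
  then show ?thesis unfolding pre_iff[OF u(1) w] using u(2) ell inv by simp
qed

lemma desc_g: "is_gen p c \<Longrightarrow> desc p c g"
  by (simp add: is_gen_def desc_def rcol_g rval_g gd_def kap_neq_1)

lemma g_D: "g \<in> LG.D"
  unfolding D_iff simple_def using g_G by (auto simp: pairs_def rval_g gd_def)

text \<open>A word is the join of two generators if both are descents of it and it strips off
  completely from every \<open>w\<close> in the interval having both as descents. Applied to
  \<open>w = g\<close>, the latter also places the word in the interval.\<close>

lemma join_by_word:
  assumes pc: "is_gen p c" and qd: "is_gen q d" and xs: "set xs \<subseteq> Xgens e n"
    and dC: "desc p c (word_prod n xs)" "desc q d (word_prod n xs)"
    and ell: "\<And>w. w \<in> LG.D \<Longrightarrow> desc p c w \<Longrightarrow> desc q d w \<Longrightarrow>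
          ell n (word_prod n (rev xs) * w) + length xs = ell n w"
  shows "\<exists>u\<in>LG.D. LG.pre (gen n p c) u \<and> LG.pre (gen n q d) u \<and>
          (\<forall>w\<in>LG.D. LG.pre (gen n p c) w \<and> LG.pre (gen n q d) w \<longrightarrow> LG.pre u w)"
proof (rule bexI)
  let ?u = "word_prod n xs"
  have u: "?u \<in> G" using word_prod_G[OF xs] by simp
  have pre: "LG.pre ?u w" if "w \<in> LG.D" "desc p c w" "desc q d w" for w
    using pre_word[OF xs _ ell[OF that]] that(1) D_iff by blast
  show "?u \<in> LG.D" using pre[OF g_D desc_g[OF pc] desc_g[OF qd]] u by (simp add: LG.D_def)
  show "LG.pre (gen n p c) ?u \<and> LG.pre (gen n q d) ?u \<and>
      (\<forall>w\<in>LG.D. LG.pre (gen n p c) w \<and> LG.pre (gen n q d) w \<longrightarrow> LG.pre ?u w)"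
    using pre dC u pc qd D_iff pre_gen_iff by auto
qed

lemma gen_mult_at:
  assumes A: "A \<in> G" and pc: "is_gen p c"
  shows "rcol (gen n p c * A) p = rcol A (Suc p)" "rcol (gen n p c * A) (Suc p) = rcol A p"
    "rval (gen n p c * A) p = inverse c * rval A (Suc p)" "rval (gen n p c * A) (Suc p) = c * rval A p"
    "\<And>i. i < n \<Longrightarrow> i \<noteq> p \<Longrightarrow> i \<noteq> Suc p \<Longrightarrow> rcol (gen n p c * A) i = rcol A i"
    "\<And>i. i < n \<Longrightarrow> i \<noteq> p \<Longrightarrow> i \<noteq> Suc p \<Longrightarrow> rval (gen n p c * A) i = rval A i"
  using gen_mult(2,3)[OF A pc] pc by (auto simp: is_gen_def sw_def gcoef_def)

lemma word_prod_mult_Cons: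
  assumes "x \<in> Xgens e n" "set xs \<subseteq> Xgens e n" "w \<in> G"
  shows "word_prod n (x # xs) * w = x * (word_prod n xs * w)"
  using assoc_n[of x n "word_prod n xs" w] Xgens_carrier[OF assms(1)] word_prod_G[OF assms(2)]
    G_carrier[OF assms(3)] G_carrier[of "word_prod n xs"] by simp

lemma word_prod_mult_Nil: "w \<in> G \<Longrightarrow> word_prod n [] * w = w"
  using left_mult_one_mat[OF G_carrier] by simp

lemma gen_Xgens: "is_gen p c \<Longrightarrow> gen n p c \<in> Xgens e n"
  unfolding Xgens_eq by blast

text \<open>As \<open>c\<close> and \<open>d\<close> differ, a common descent cannot come from an
  inversion, so rows \<open>0\<close> and \<open>1\<close> of \<open>w\<close> are in increasing
  position with a value other than 1 in row \<open>1\<close>. Being simple, \<open>w\<close> has the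
  value \<open>kap\<close> there. After the first generator the rows are inverted with
  \<open>inverse c * kap\<close> in row \<open>0\<close>, and the second generator removes this
  inversion.\<close>

lemma join_first_row:
  assumes c: "is_gen 0 c" and d: "is_gen 0 d" and ne: "c \<noteq> d"
  shows "\<exists>u\<in>LG.D. LG.pre (gen n 0 c) u \<and> LG.pre (gen n 0 d) u \<and>
          (\<forall>w\<in>LG.D. LG.pre (gen n 0 c) w \<and> LG.pre (gen n 0 d) w \<longrightarrow> LG.pre u w)"
proof -
  \<comment> \<open>With this parameter the product of the two generators is diagonal in rows
    \<open>0\<close> and \<open>1\<close> with entries \<open>inverse kap\<close> and
    \<open>kap\<close>, independently of \<open>c\<close>. For \<open>c = zeta e ^ i\<close> it is
    the product of the generators with indices \<open>i\<close> and \<open>i - k\<close> modulo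
    \<open>e\<close>.\<close>
  define b where "b = c * inverse kap"
  have kape: "kap ^ e = 1" using gd_power[of 1] by (simp add: gd_def)
  have b: "is_gen 0 b"
    using c kape by (simp add: is_gen_def b_def power_mult_distrib power_inverse)
  have c0: "c \<noteq> 0" using is_gen_neq_0[OF c] .
  let ?x = "gen n 0 c" and ?y = "gen n 0 b"
  have X: "?x \<in> Xgens e n" "?y \<in> Xgens e n" using gen_Xgens b c by auto
  have n1: "Suc 0 < n" using n by simp
  note B = gen_mult_at[OF one_G b] and BG = gen_mult(1)[OF one_G b]
  note C = gen_mult_at[OF BG c]
  have one: "rcol (1\<^sub>m n) 0 = 0" "rcol (1\<^sub>m n) (Suc 0) = Suc 0" "rval (1\<^sub>m n) 0 = 1"
    "rval (1\<^sub>m n) (Suc 0) = 1" using n1 by (auto simp: rcol_one rval_one)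
  have wp: "word_prod n [?x, ?y] = ?x * (?y * 1\<^sub>m n)" by simp
  have "c * inverse b = kap" using c0 kap_neq_0 by (simp add: b_def)
  then have dC: "desc 0 a (word_prod n [?x, ?y])" for a
    unfolding wp desc_def using B C one kap_neq_1 by simp
  have ell: "ell n (word_prod n (rev [?x, ?y]) * w) + length [?x, ?y] = ell n w"
    if w: "w \<in> LG.D" "desc 0 c w" "desc 0 d w" for w
  proof -
    have wG: "w \<in> G" "simple w" using w(1) D_iff by auto
    have "\<not> (c * rval w 0 = 1 \<and> d * rval w 0 = 1)"
      using ne by (metis mult_right_cancel mult_zero_right zero_neq_one)
    then have lt: "rcol w 0 < rcol w (Suc 0)" and v: "rval w (Suc 0) \<noteq> 1"
      using w(2,3) by (auto simp: desc_def)
    have "(0, Suc 0) \<in> pairs n" using n by (simp add: pairs_def)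
    then have kap: "rval w (Suc 0) = kap" using wG(2) lt v unfolding simple_def by blast
    note W = gen_mult_at[OF wG(1) c] and WG = gen_mult(1)[OF wG(1) c]
    have "b * (inverse c * kap) = 1" using c0 kap_neq_0 by (simp add: b_def field_simps)
    then have "desc 0 b (?x * w)" unfolding desc_def using W lt kap by simp
    then have "ell n w = ell n (?y * (?x * w)) + 2"
      using ell_desc(1)[OF wG(1) c w(2)] ell_desc(1)[OF WG b] by simp
    moreover have "word_prod n (rev [?x, ?y]) * w = ?y * (?x * w)"
      using X wG word_prod_mult_Cons[of ?y "[?x]" w] word_prod_mult_Cons[of ?x "[]" w]
        word_prod_mult_Nil[OF wG(1)] by simp
    ultimately show ?thesis by simp
  qed
  show ?thesis using join_by_word[OF c d _ dC dC ell] X by simp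
qed

text \<open>The braid word reverses the order of rows \<open>p\<close>, \<open>p + 1\<close> and
  \<open>p + 2\<close>. If \<open>w\<close> has both descents, its three letters are descents one
  after the other, so the whole word strips off.\<close>

lemma join_braid:
  assumes c: "is_gen p c" and q: "is_gen (Suc p) 1"
  shows "\<exists>u\<in>LG.D. LG.pre (gen n p c) u \<and> LG.pre (gen n (Suc p) 1) u \<and>
          (\<forall>w\<in>LG.D. LG.pre (gen n p c) w \<and> LG.pre (gen n (Suc p) 1) w \<longrightarrow> LG.pre u w)"
proof -
  let ?x = "gen n p c" and ?y = "gen n (Suc p) 1"
  have X: "?x \<in> Xgens e n" "?y \<in> Xgens e n" using gen_Xgens q c by auto
  have p: "p < n" "Suc p < n" "Suc (Suc p) < n" using q by (auto simp: is_gen_def)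
  have c0: "c \<noteq> 0" using is_gen_neq_0[OF c] .
  have xyx: "rcol (?x * (?y * (?x * w))) p = rcol w (Suc (Suc p))"
    "rcol (?x * (?y * (?x * w))) (Suc p) = rcol w (Suc p)"
    "rcol (?x * (?y * (?x * w))) (Suc (Suc p)) = rcol w p"
    "rval (?x * (?y * (?x * w))) p = inverse c * rval w (Suc (Suc p))"
    "rval (?x * (?y * (?x * w))) (Suc p) = rval w (Suc p)"
    "rval (?x * (?y * (?x * w))) (Suc (Suc p)) = c * rval w p"
    "desc p c w \<Longrightarrow> desc (Suc p) 1 w \<Longrightarrow> desc (Suc p) 1 (?x * w)"
    "desc p c w \<Longrightarrow> desc (Suc p) 1 w \<Longrightarrow> desc p c (?y * (?x * w))"
    "?x * w \<in> G" "?y * (?x * w) \<in> G"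
    if w: "w \<in> G" for w
  proof -
    note A = gen_mult_at[OF w c] and AG = gen_mult(1)[OF w c]
    note B = gen_mult_at[OF AG q] and BG = gen_mult(1)[OF AG q]
    note C = gen_mult_at[OF BG c]
    show "?x * w \<in> G" "?y * (?x * w) \<in> G" by (rule AG BG)+
    show "rcol (?x * (?y * (?x * w))) p = rcol w (Suc (Suc p))"
      "rcol (?x * (?y * (?x * w))) (Suc p) = rcol w (Suc p)"
      "rcol (?x * (?y * (?x * w))) (Suc (Suc p)) = rcol w p"
      "rval (?x * (?y * (?x * w))) p = inverse c * rval w (Suc (Suc p))"
      "rval (?x * (?y * (?x * w))) (Suc p) = rval w (Suc p)"
      "rval (?x * (?y * (?x * w))) (Suc (Suc p)) = c * rval w p"
      using A B C p c0 by simp_all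
    have ne: "rcol w p \<noteq> rcol w (Suc (Suc p))"
      using inj_onD[OF rcol_inj[OF w], of p "Suc (Suc p)"] p by auto
    assume d: "desc p c w" "desc (Suc p) 1 w"
    \<comment> \<open>If row \<open>p + 1\<close> had the largest of the three columns, the two
      descents would require its value to be both different from 1 and equal to 1. This
      contradiction removes the mixed case.\<close>
    show "desc (Suc p) 1 (?x * w)" using d ne A p unfolding desc_def by auto
    show "desc p c (?y * (?x * w))" using d A B p c0 unfolding desc_def by auto
  qed
  have one: "rcol (1\<^sub>m n) p = p" "rcol (1\<^sub>m n) (Suc p) = Suc p" "rcol (1\<^sub>m n) (Suc (Suc p)) = Suc (Suc p)"
    "rval (1\<^sub>m n) p = 1" "rval (1\<^sub>m n) (Suc p) = 1" "rval (1\<^sub>m n) (Suc (Suc p)) = 1"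
    using p by (auto simp: rcol_one rval_one)
  have wp: "word_prod n [?x, ?y, ?x] = ?x * (?y * (?x * 1\<^sub>m n))" by simp
  have dC: "desc p c (word_prod n [?x, ?y, ?x])" "desc (Suc p) 1 (word_prod n [?x, ?y, ?x])"
    unfolding wp desc_def xyx(1-6)[OF one_G] one using c0 by simp_all
  have ell: "ell n (word_prod n (rev [?x, ?y, ?x]) * w) + length [?x, ?y, ?x] = ell n w"
    if w: "w \<in> LG.D" "desc p c w" "desc (Suc p) 1 w" for w
  proof -
    have wG: "w \<in> G" using w(1) D_iff by auto
    have "ell n w = ell n (?x * (?y * (?x * w))) + 3"
      using ell_desc(1)[OF wG c w(2)] ell_desc(1)[OF xyx(9)[OF wG] q xyx(7)[OF wG w(2,3)]]
        ell_desc(1)[OF xyx(10)[OF wG] c xyx(8)[OF wG w(2,3)]] by simp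
    moreover have "word_prod n (rev [?x, ?y, ?x]) * w = ?x * (?y * (?x * w))"
      using X wG word_prod_mult_Cons[of ?x "[?y, ?x]" w] word_prod_mult_Cons[of ?y "[?x]" w]
        word_prod_mult_Cons[of ?x "[]" w] word_prod_mult_Nil[OF wG] by simp
    ultimately show ?thesis by simp
  qed
  show ?thesis using join_by_word[OF c q _ dC ell] X by simp
qed

text \<open>The two generators act on disjoint pairs of rows, so each descent survives the other
  multiplication.\<close>

lemma join_commuting:
  assumes c: "is_gen p c" and q: "is_gen q d" and pq: "Suc p < q"
  shows "\<exists>u\<in>LG.D. LG.pre (gen n p c) u \<and> LG.pre (gen n q d) u \<and>
          (\<forall>w\<in>LG.D. LG.pre (gen n p c) w \<and> LG.pre (gen n q d) w \<longrightarrow> LG.pre u w)"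
proof -
  let ?x = "gen n p c" and ?y = "gen n q d"
  have X: "?x \<in> Xgens e n" "?y \<in> Xgens e n" using gen_Xgens q c by auto
  have p: "p < n" "Suc p < n" "q < n" "Suc q < n" using q pq by (auto simp: is_gen_def)
  have c0: "c \<noteq> 0" "d = 1" using is_gen_neq_0[OF c] q pq by (auto simp: is_gen_def)
  note B = gen_mult_at[OF one_G q] and BG = gen_mult(1)[OF one_G q]
  note C = gen_mult_at[OF BG c]
  have wp: "word_prod n [?x, ?y] = ?x * (?y * 1\<^sub>m n)" by simp
  have dC: "desc p c (word_prod n [?x, ?y])" "desc q d (word_prod n [?x, ?y])"
    unfolding wp desc_def using B C c0 p pq by (simp_all add: rcol_one rval_one)
  have ell: "ell n (word_prod n (rev [?x, ?y]) * w) + length [?x, ?y] = ell n w"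
    if w: "w \<in> LG.D" "desc p c w" "desc q d w" for w
  proof -
    have wG: "w \<in> G" using w(1) D_iff by auto
    note W = gen_mult_at[OF wG c] and WG = gen_mult(1)[OF wG c]
    have "desc q d (?x * w)" using w(3) W p pq unfolding desc_def by simp
    then have "ell n w = ell n (?y * (?x * w)) + 2"
      using ell_desc(1)[OF wG c w(2)] ell_desc(1)[OF WG q] by simp
    moreover have "word_prod n (rev [?x, ?y]) * w = ?y * (?x * w)"
      using X wG word_prod_mult_Cons[of ?y "[?x]" w] word_prod_mult_Cons[of ?x "[]" w]
        word_prod_mult_Nil[OF wG] by simp
    ultimately show ?thesis by simp
  qed
  show ?thesis using join_by_word[OF c q _ dC ell] X by simp
qed

lemma join_less:
  assumes c: "is_gen p c" and q: "is_gen q d" and pq: "p < q"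
  shows "\<exists>u\<in>LG.D. LG.pre (gen n p c) u \<and> LG.pre (gen n q d) u \<and>
          (\<forall>w\<in>LG.D. LG.pre (gen n p c) w \<and> LG.pre (gen n q d) w \<longrightarrow> LG.pre u w)"
proof (cases "q = Suc p")
  case True
  then have "d = 1" using q by (simp add: is_gen_def)
  then show ?thesis using join_braid[of p c] c q True by simp
next
  case False
  then show ?thesis using join_commuting[OF c q] pq by simp
qed

lemma atom_join:
  assumes "x \<in> Xgens e n" "y \<in> Xgens e n" "x \<noteq> y"
  shows "\<exists>u\<in>LG.D. LG.pre x u \<and> LG.pre y u \<and> (\<forall>w\<in>LG.D. LG.pre x w \<and> LG.pre y w \<longrightarrow> LG.pre u w)"
proof -
  obtain p c where x: "x = gen n p c" "is_gen p c" using assms(1) by (rule XgensE)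
  obtain q d where y: "y = gen n q d" "is_gen q d" using assms(2) by (rule XgensE)
  consider "p < q" | "q < p" | "p = q" by linarith
  then show ?thesis
  proof cases
    case 1
    then show ?thesis unfolding x(1) y(1) by (rule join_less[OF x(2) y(2)])
  next
    case 2
    then show ?thesis unfolding x(1) y(1) using join_less[OF y(2) x(2)] by blast
  next
    case 3
    have "c \<noteq> d" using assms(3) x(1) y(1) 3 by blast
    then have "p = 0" using x(2) y(2) 3 by (auto simp: is_gen_def split: if_splits)
    then show ?thesis using join_first_row[of c d] x y 3 \<open>c \<noteq> d\<close> by simp
  qed
qed

section \<open>The interval as a germ and the final statement\<close>

lemma finite_D: "finite LG.D"
proof -
  have "Xgens e n = (\<lambda>i. tgen e n i) ` {..<e} \<union> (\<lambda>j. sgen n j) ` {3..n}"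
    unfolding Xgens_def by auto
  then have "finite (Xgens e n)" by simp
  then have "finite {xs. set xs \<subseteq> Xgens e n \<and> length xs \<le> ell n g}" by (rule finite_lists_length_le)
  moreover have "LG.D \<subseteq> word_prod n ` {xs. set xs \<subseteq> Xgens e n \<and> length xs \<le> ell n g}"
  proof
    fix w assume w: "w \<in> LG.D"
    then have wG: "w \<in> G" by (simp add: D_iff)
    have "ell n w \<le> ell n g" using w pre_iff[OF wG g_G] by (simp add: LG.D_def)
    then show "w \<in> word_prod n ` {xs. set xs \<subseteq> Xgens e n \<and> length xs \<le> ell n g}"
      using ex_word[OF wG] by force
  qed
  ultimately show ?thesis by (rule finite_surj)
qed

lemma g_transpose: "transpose_mat g = g"
  using g_carrier by (intro eq_matI) (auto simp: g_index)

sublocale IG: interval_group GG "len e n" g "Xgens e n" transpose_mat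
proof
  show "Xgens e n \<subseteq> carrier GG" using gen_G(1) by (auto elim: XgensE)
  show "len e n \<one>\<^bsub>GG\<^esub> = 0" using len_eq_ell[OF one_G] ell_one by simp
  show "w = \<one>\<^bsub>GG\<^esub>" if "w \<in> carrier GG" "len e n w = 0" for w
    using that ex_word[of w] len_eq_ell[of w] by auto
  show "len e n (u \<otimes>\<^bsub>GG\<^esub> w) \<le> len e n u + len e n w" if "u \<in> carrier GG" "w \<in> carrier GG" for u w
    using that mult_G by (simp add: len_eq_ell)
  show "len e n x = 1" if "x \<in> Xgens e n" for x
    using that by (rule XgensE) (simp add: len_eq_ell gen_G)
  show "\<exists>x\<in>Xgens e n. LG.pre x w" if "w \<in> carrier GG" "w \<noteq> \<one>\<^bsub>GG\<^esub>" for w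
    using ex_desc[of w] pre_gen_iff[of _ _ w] gen_Xgens that by auto
  show "g \<in> carrier GG" using g_G by simp
  show "len e n w + len e n (inv\<^bsub>GG\<^esub> w \<otimes>\<^bsub>GG\<^esub> g) = len e n g \<longleftrightarrow>
      len e n w + len e n (g \<otimes>\<^bsub>GG\<^esub> inv\<^bsub>GG\<^esub> w) = len e n g" if "w \<in> carrier GG" for w
  proof -
    have w: "w \<in> G" "inv\<^bsub>GG\<^esub> w \<in> G" using that GG.inv_closed[of w] by auto
    \<comment> \<open>Balance holds because both equations are equivalent to
      \<open>simple w\<close>.\<close>
    then show ?thesis
      using prefix_iff_simple[OF w(1)] suffix_iff_simple[OF w(1)] g_G mult_G(1)
      by (simp add: len_eq_ell)
  qed
  show "finite LG.D" by (rule finite_D)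
  show "\<exists>c\<in>LG.D. LG.pre x c \<and> LG.pre y c \<and> (\<forall>w\<in>LG.D. LG.pre x w \<and> LG.pre y w \<longrightarrow> LG.pre c w)"
    if "x \<in> Xgens e n" "y \<in> Xgens e n" "x \<noteq> y" for x y
    using that by (rule atom_join)
  show "transpose_mat (u \<otimes>\<^bsub>GG\<^esub> w) = transpose_mat w \<otimes>\<^bsub>GG\<^esub> transpose_mat u"
    if "u \<in> carrier GG" "w \<in> carrier GG" for u w
    using that transpose_mult[of u n n w n] G_carrier by simp
qed (auto simp: transpose_G len_eq_ell g_transpose)

lemma D_eq_interval: "LG.D = interval e n g"
  unfolding LG.D_def interval_def prec_def LG.pre_def using minv_eq by auto

lemma rels_eq: "IG.germ.rels = interval_rels e n g"
  unfolding IG.germ.rels_def interval_rels_def IG.P_def D_eq_interval by auto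

theorem garside:
  "garside_monoid (interval_monoid e n g) (underline e n g g)"
  "{a \<in> carrier (interval_monoid e n g). ldiv (interval_monoid e n g) a (underline e n g g)} =
     underline e n g ` interval e n g"
  "inj_on (frac_map (interval e n g) (interval_rels e n g)) (carrier (interval_monoid e n g))"
proof -
  have M: "interval_monoid e n g = pres_monoid LG.D IG.germ.rels"
    unfolding interval_monoid_def D_eq_interval rels_eq ..
  have u: "underline e n g = (\<lambda>w. pres_class IG.germ.rels [w])"
    unfolding underline_def rels_eq ..
  show "garside_monoid (interval_monoid e n g) (underline e n g g)"
    unfolding M u by (rule IG.germ.garside_monoid_M)
  show "{a \<in> carrier (interval_monoid e n g). ldiv (interval_monoid e n g) a (underline e n g g)} =
     underline e n g ` interval e n g"
    unfolding M u D_eq_interval[symmetric] by (rule IG.germ.left_divisors_g)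
  show "inj_on (frac_map (interval e n g) (interval_rels e n g)) (carrier (interval_monoid e n g))"
    unfolding M D_eq_interval[symmetric] rels_eq[symmetric] by (rule IG.germ.inj_on_frac_map)
qed

end

theorem mainTheorem9:
  fixes e n k :: nat
  assumes "e \<ge> 2" and "n \<ge> 2" and "1 \<le> k" and "k \<le> e - 1"
  defines "g \<equiv> lam e n ^\<^sub>m k"
  defines "M \<equiv> interval_monoid e n g"
  shows "garside_monoid M (underline e n g g)
       \<and> {a \<in> carrier M. ldiv M a (underline e n g g)} = underline e n g ` interval e n g
       \<and> inj_on (frac_map (interval e n g) (interval_rels e n g)) (carrier M)"
proof -
  interpret geen_interval e n k by unfold_locales (use assms in auto)
  have "g = geen_interval.g e n k" unfolding g_def assms(5) by simp
  then show ?thesis unfolding M_def using garside by simp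
qed

end
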